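(* For all integers $d>3$ and $0\le i\le d-4$, there exists a stacked $d$-polytope that is not (strongly) $(i,i+1)$-scribable.
   Context: Let $\mathbb S^d=\{x\in\mathbb R^{d+1}:\|x\|_2=1\}$, with coordinates $x_0,\dots,x_d$. A spherical polytope is an intersection of finitely many closed hemispheres of $\mathbb S^d$ containing no two antipodal points; equivalently, $\mathcal P=\mathcal K\cap\mathbb S^d$ for a pointed polyhedral cone $\mathcal K\subset\mathbb R^{d+1}$. Its $k$-faces are the intersections with $\mathbb S^d$ of the $(k+1)$-dimensional faces of $\mathcal K$. A $d$-polytope is a polytope of dimension $d$. Every Euclidean $d$-polytope has the same face lattice as some spherical $d$-polytope and conversely. A realization of a combinatorial type of $d$-polytope is a spherical $d$-polytope in $\mathbb S^d$ with isomorphic face lattice. Let $\mathcal B=\{x\in\mathbb S^d: x_0\ge 0,\ -x_0^2+x_1^2+\dots+x_d^2\le 0\}$ (a spherical cap) and let $\mathcal S=\partial\mathcal B$. A supporting hyperplane of $\mathcal P$ is a hyperplane $H$ of $\mathbb S^d$ (intersection with a linear hyperplane) that meets $\mathcal P$ and such that $\mathcal P$ lies in one of the two closed hemispheres bounded by $H$, denoted $H^-$. A proper face $F$ of $\mathcal P$ strongly cuts $\mathcal S$ if $\operatorname{relint}(F)\cap\mathcal B\ne\emptyset$; it strongly avoids $\mathcal S$ if there is a supporting hyperplane $H$ of $\mathcal P$ with $F=H\cap\mathcal P$ and $\mathcal B\subset H^-$. For $0\le i\le j\le d-1$, $\mathcal P$ is (strongly) $(i,j)$-scribed if every $i$-face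 strongly avoids $\mathcal S$ and every $j$-face strongly cuts $\mathcal S$. A (combinatorial type of) $d$-polytope is (strongly) $(i,j)$-scribable if it has a strongly $(i,j)$-scribed realization. Stacking a vertex onto a simplicial facet $F$ of a $d$-polytope $\mathcal P$ means taking the convex hull of $\mathcal P\cup\{p\}$ for a point $p\notin \mathcal P$ close enough to the barycenter of $F$. A stacked $d$-polytope is any $d$-polytope obtained (combinatorially) from a $d$-simplex by repeatedly stacking vertices onto facets. *)

theory Defs
  imports "HOL-Analysis.Analysis"
begin

section \<open>Spherical polytopes\<close>

text \<open>
  The ambient space $R^{d+1}$ of the sphere $S^d$ is the Euclidean space
  \<^typ>\<open>real \<times> (real^'d)\<close> with \<open>d = CARD('d)\<close>: the first component is the distinguished
  coordinate $x_0$ and the second one collects $x_1,\dots,x_d$.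
\<close>

definition hemisphere :: "'a::euclidean_space \<Rightarrow> 'a set" where
  "hemisphere a = {x \<in> sphere 0 1. a \<bullet> x \<le> 0}"

definition spherical_polytope :: "'a::euclidean_space set \<Rightarrow> bool" where
  "spherical_polytope P \<longleftrightarrow>
     (\<exists>A. finite A \<and> 0 \<notin> A \<and> P = sphere 0 1 \<inter> (\<Inter>a\<in>A. hemisphere a)) \<and>
     (\<forall>x\<in>P. - x \<notin> P)"

text \<open>
  The cone whose intersection with the sphere is \<open>P\<close>. The origin is added because the
  library's conic hull of the empty set is empty.
\<close>

definition cone_over :: "'a::euclidean_space set \<Rightarrow> 'a set" where
  "cone_over P = insert 0 (conic hull P)"

definition spherical_dim :: "'a::euclidean_space set \<Rightarrow> int" where
  "spherical_dim P = aff_dim (cone_over P) - 1"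

definition spherical_faces :: "'a::euclidean_space set \<Rightarrow> 'a set set" where
  "spherical_faces P = {G \<inter> sphere 0 1 |G. G face_of cone_over P}"

definition spherical_k_face :: "nat \<Rightarrow> 'a::euclidean_space set \<Rightarrow> 'a set \<Rightarrow> bool" where
  "spherical_k_face k F P \<longleftrightarrow>
     (\<exists>G. G face_of cone_over P \<and> aff_dim G = int k + 1 \<and> F = G \<inter> sphere 0 1)"

text \<open>
  The relative interior within the sphere: the affine hull of \<open>F\<close> itself has the wrong
  dimension, so the relative interior is taken in the cone.
\<close>

definition spherical_relint :: "'a::euclidean_space set \<Rightarrow> 'a set" where
  "spherical_relint F = rel_interior (cone_over F) \<inter> sphere 0 1"

definition supporting_hyperplane ::
    "'a::euclidean_space set \<Rightarrow> 'a set \<Rightarrow> 'a set \<Rightarrow> bool" where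
  "supporting_hyperplane P H Hminus \<longleftrightarrow>
     (\<exists>a. a \<noteq> 0 \<and> H = {x \<in> sphere 0 1. a \<bullet> x = 0} \<and> Hminus = hemisphere a) \<and>
     H \<inter> P \<noteq> {} \<and> P \<subseteq> Hminus"


section \<open>Scribability\<close>

definition cap :: "(real \<times> (real^'d)) set" where
  "cap = {x \<in> sphere 0 1. fst x \<ge> 0 \<and> - (fst x)\<^sup>2 + (\<Sum>k\<in>UNIV. (snd x $ k)\<^sup>2) \<le> 0}"

definition strongly_cuts :: "(real \<times> (real^'d)) set \<Rightarrow> bool" where
  "strongly_cuts F \<longleftrightarrow> spherical_relint F \<inter> cap \<noteq> {}"

definition strongly_avoids ::
    "(real \<times> (real^'d)) set \<Rightarrow> (real \<times> (real^'d)) set \<Rightarrow> bool" where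
  "strongly_avoids P F \<longleftrightarrow>
     (\<exists>H Hminus. supporting_hyperplane P H Hminus \<and> F = H \<inter> P \<and> cap \<subseteq> Hminus)"

definition strongly_scribed :: "nat \<Rightarrow> nat \<Rightarrow> (real \<times> (real^'d)) set \<Rightarrow> bool" where
  "strongly_scribed i j P \<longleftrightarrow>
     (\<forall>F. spherical_k_face i F P \<longrightarrow> strongly_avoids P F) \<and>
     (\<forall>F. spherical_k_face j F P \<longrightarrow> strongly_cuts F)"

definition inclusion_isomorphic :: "'a set set \<Rightarrow> 'b set set \<Rightarrow> bool" where
  "inclusion_isomorphic A B \<longleftrightarrow>
     (\<exists>f. bij_betw f A B \<and> (\<forall>F\<in>A. \<forall>G\<in>A. F \<subseteq> G \<longleftrightarrow> f F \<subseteq> f G))"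

text \<open>
  A combinatorial type of \<open>d\<close>-polytopes is represented by a Euclidean \<open>d\<close>-polytope in $R^d$.
\<close>

definition spherical_realization :: "(real \<times> (real^'d)) set \<Rightarrow> (real^'d) set \<Rightarrow> bool" where
  "spherical_realization Q P \<longleftrightarrow>
     spherical_polytope Q \<and> spherical_dim Q = int CARD('d) \<and>
     inclusion_isomorphic {F. F face_of P} (spherical_faces Q)"

definition strongly_scribable :: "nat \<Rightarrow> nat \<Rightarrow> (real^'d) set \<Rightarrow> bool" where
  "strongly_scribable i j P \<longleftrightarrow>
     (\<exists>Q. spherical_realization Q P \<and> strongly_scribed i j Q)"


section \<open>Stacked polytopes\<close>

definition combinatorially_equivalent ::
    "'a::euclidean_space set \<Rightarrow> 'b::euclidean_space set \<Rightarrow> bool" where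
  "combinatorially_equivalent P Q \<longleftrightarrow>
     inclusion_isomorphic {F. F face_of P} {F. F face_of Q}"

text \<open>The mean of the vertices, which is the barycenter when \<open>F\<close> is a simplex.\<close>

definition barycenter :: "'a::euclidean_space set \<Rightarrow> 'a" where
  "barycenter F =
     (1 / real (card {v. v extreme_point_of F})) *\<^sub>R \<Sum>{v. v extreme_point_of F}"

text \<open>
  In \<open>stack\<close>, \<open>Q\<close> has the combinatorial type of the polytope obtained from \<open>P\<close> by stacking a
  vertex onto \<open>F\<close>, that is, of the convex hull of \<open>P\<close> and \<open>p\<close> for all points \<open>p\<close> outside \<open>P\<close>
  sufficiently close to the barycenter of \<open>F\<close>.
\<close>

inductive stacked :: "(real^'d) set \<Rightarrow> bool" where
  simplex: "int CARD('d) simplex P \<Longrightarrow> stacked P" for P :: "(real^'d) set"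
| stack: "\<lbrakk>stacked P; F facet_of P; (int CARD('d) - 1) simplex F;
           polytope Q; aff_dim Q = int CARD('d);
           \<forall>\<^sub>F p in at (barycenter F) within (- P).
             combinatorially_equivalent Q (convex hull (insert p P))\<rbrakk>
          \<Longrightarrow> stacked Q" for P Q :: "(real^'d) set"

end

theory Submission
  imports Defs
begin

text \<open>
  Fix a set \<open>T\<close> of \<open>i\<close> vertices and look only at faces containing \<open>T\<close>; put \<open>D = d - i \<ge> 4\<close>. Outward
  normals of the facets of a scribed realization are measured with the Lorentz form \<open>lor\<close>.
  If an \<open>(i+1)\<close>-face cuts the sphere, then \<open>lor\<close> is positive semidefinite on the functionals
  vanishing on that face, so these functionals make angles that obey spherical geometry; if an
  \<open>i\<close>-face avoids the sphere, it has a supporting functional \<open>y\<close> with \<open>lor y y \<le> 0\<close>.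

  Stack a vertex \<open>p\<close> onto a facet \<open>F\<close>, with normal \<open>n\<close>, and let \<open>n_f\<close> be the normal of the new facet that
  replaces \<open>f\<close> by \<open>p\<close>; put \<open>\<theta>_f = ang n n_f\<close>, for the \<open>D\<close> vertices \<open>f\<close> outside \<open>T\<close>. The triangle
  inequality gives \<open>ang n_f n_g \<le> \<theta>_f + \<theta>_g\<close>. Since \<open>T\<close> together with \<open>p\<close> avoids the sphere, some positive
  combination \<open>y\<close> of the \<open>n_f\<close> satisfies \<open>lor y y \<le> 0\<close>, so one of the angles \<open>ang n_f n_g\<close> is at least
  \<open>pi / 2\<close>; hence the angles \<open>\<theta>_f\<close> sum to at least \<open>pi / 2\<close>.
  Stack again onto each new facet, and so on for \<open>k\<close> rounds. If every facet in the next generation uses up a total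
  angle of at least \<open>L\<close> at its ridges, then at most \<open>(D - 1) \<Sum> \<theta>_f\<close> of the total \<open>D L\<close> fits between the
  new facets, and the rest is used at the ridges of \<open>F\<close>. So \<open>F\<close> uses up at least
  \<open>max (\<Sum> \<theta>_f) (D L - (D - 2) \<Sum> \<theta>_f) \<ge> D / (D - 1) * L\<close>. This grows exponentially in \<open>k\<close>,
  whereas by convexity it is at most \<open>D pi\<close>.
\<close>

section \<open>Angles for the Lorentz form\<close>

definition lor :: "real \<times> 'b::real_inner \<Rightarrow> real \<times> 'b \<Rightarrow> real" where
  "lor a b = snd a \<bullet> snd b - fst a * fst b"

lemma lor_commute: "lor a b = lor b a"
  by (simp add: lor_def inner_commute mult.commute)

lemma lor_add_left [simp]: "lor (a + b) c = lor a c + lor b c"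
  and lor_add_right [simp]: "lor c (a + b) = lor c a + lor c b"
  and lor_scaleR_left [simp]: "lor (r *\<^sub>R a) c = r * lor a c"
  and lor_scaleR_right [simp]: "lor c (r *\<^sub>R a) = r * lor c a"
  and lor_diff_left [simp]: "lor (a - b) c = lor a c - lor b c"
  and lor_diff_right [simp]: "lor c (a - b) = lor c a - lor c b"
  by (simp_all add: lor_def algebra_simps inner_simps)

lemma lor_sum_left: "lor (\<Sum>i\<in>I. f i) c = (\<Sum>i\<in>I. lor (f i) c)"
  by (induction I rule: infinite_finite_induct) (simp_all, simp_all add: lor_def)

lemma lor_sum_right: "lor c (\<Sum>i\<in>I. f i) = (\<Sum>i\<in>I. lor c (f i))"
  by (simp add: lor_commute[of c] lor_sum_left)

text \<open>Here \<open>x\<close> is a point and \<open>a\<close> a functional paired with it by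
  \<open>\<bullet>\<close>. If \<open>x\<close> lies in the closed light cone, Cauchy-Schwarz on the
  last coordinates turns \<open>a \<bullet> x = 0\<close> into
  \<open>\<bar>fst a\<bar> \<le> norm (snd a)\<close>.\<close>

lemma lor_nonneg:
  assumes "x \<noteq> 0" "lor x x \<le> 0" "a \<bullet> x = 0"
  shows "0 \<le> lor a a"
proof -
  have nx: "norm (snd x) \<le> \<bar>fst x\<bar>"
  proof -
    have "(norm (snd x))\<^sup>2 \<le> (fst x)\<^sup>2" using assms(2) by (simp add: lor_def dot_square_norm power2_eq_square)
    then show ?thesis using abs_le_square_iff[of "norm (snd x)" "fst x"] by simp
  qed
  have f0: "fst x \<noteq> 0"
  proof
    assume "fst x = 0" then have "snd x = 0" using nx by simp
    with \<open>fst x = 0\<close> assms(1) show False by (simp add: prod_eq_iff)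
  qed
  have "\<bar>fst a\<bar> * \<bar>fst x\<bar> = \<bar>snd a \<bullet> snd x\<bar>"
    using assms(3) by (simp add: inner_prod_def abs_mult[symmetric])
  also have "\<dots> \<le> norm (snd a) * norm (snd x)" by (rule Cauchy_Schwarz_ineq2)
  also have "\<dots> \<le> norm (snd a) * \<bar>fst x\<bar>" by (intro mult_left_mono nx) simp
  finally have "\<bar>fst a\<bar> \<le> norm (snd a)" using f0 by simp
  then have "(fst a)\<^sup>2 \<le> (norm (snd a))\<^sup>2" by (simp add: abs_le_square_iff[symmetric])
  then show ?thesis by (simp add: lor_def dot_square_norm power2_eq_square)
qed

lemma lor_pos:
  assumes "lor x x < 0" "a \<bullet> x = 0" "a \<noteq> 0"
  shows "0 < lor a a"
proof -
  have nx: "norm (snd x) < \<bar>fst x\<bar>"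
  proof -
    have "(norm (snd x))\<^sup>2 < \<bar>fst x\<bar>\<^sup>2" using assms(1) by (simp add: lor_def dot_square_norm power2_eq_square)
    then show ?thesis by (rule power2_less_imp_less) simp
  qed
  have eq: "\<bar>fst a\<bar> * \<bar>fst x\<bar> = \<bar>snd a \<bullet> snd x\<bar>"
    using assms(2) by (simp add: inner_prod_def abs_mult[symmetric])
  have sa: "snd a \<noteq> 0"
  proof
    assume *: "snd a = 0"
    then have "fst a = 0" using eq nx by auto
    with * assms(3) show False by (simp add: prod_eq_iff)
  qed
  have "\<bar>snd a \<bullet> snd x\<bar> \<le> norm (snd a) * norm (snd x)" by (rule Cauchy_Schwarz_ineq2)
  also have "\<dots> < norm (snd a) * \<bar>fst x\<bar>" using nx sa by simp
  finally have "\<bar>fst a\<bar> * \<bar>fst x\<bar> < norm (snd a) * \<bar>fst x\<bar>" using eq by simp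
  then have "\<bar>fst a\<bar> < norm (snd a)" by (simp add: mult_less_cancel_right)
  then have "(fst a)\<^sup>2 < (norm (snd a))\<^sup>2" using power_strict_mono[of "\<bar>fst a\<bar>" "norm (snd a)" 2] by simp
  then show ?thesis by (simp add: lor_def dot_square_norm power2_eq_square)
qed

lemma lor_pos_of_two:
  assumes x: "norm x = 1" "0 \<le> fst x" "lor x x \<le> 0"
    and y: "norm y = 1" "0 \<le> fst y" "lor y y \<le> 0"
    and "x \<noteq> y" "a \<bullet> x = 0" "a \<bullet> y = 0" "a \<noteq> 0"
  shows "0 < lor a a"
  \<comment> \<open>two distinct points of the cap have a midpoint inside the open light cone\<close>
proof (rule lor_pos[of "x + y"])
  have "norm (snd z) \<le> fst z" if "0 \<le> fst z" "lor z z \<le> 0" for z :: "real \<times> 'a"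
  proof (rule power2_le_imp_le)
    show "(norm (snd z))\<^sup>2 \<le> (fst z)\<^sup>2"
      using that(2) by (simp add: lor_def dot_square_norm power2_eq_square)
  qed fact
  then have nx: "norm (snd x) \<le> fst x" and ny: "norm (snd y) \<le> fst y"
    using x y by blast+
  have c: "lor x y \<le> 0"
  proof -
    have "snd x \<bullet> snd y \<le> norm (snd x) * norm (snd y)" by (rule norm_cauchy_schwarz)
    also have "\<dots> \<le> fst x * fst y" by (intro mult_mono nx ny) (use x in auto)
    finally show ?thesis by (simp add: lor_def)
  qed
  show "lor (x + y) (x + y) < 0"
  proof (rule ccontr)
    \<comment> \<open>Equality case: both points are lightlike and \<open>lor\<close>-orthogonal.
      Unit norm then makes their first coordinates equal, and the difference of the last coordinates
      has length zero.\<close>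
    assume "\<not> ?thesis"
    then have "lor x x + 2 * lor x y + lor y y \<ge> 0" by (simp add: lor_commute[of y x])
    then have 0: "lor x x = 0" "lor x y = 0" "lor y y = 0" using c x y by linarith+
    have "x \<bullet> x = 1" "y \<bullet> y = 1" using x y by (simp_all add: norm_eq_1)
    then have f: "fst x * fst x = 1/2" "fst y * fst y = 1/2"
      using 0 by (simp_all add: lor_def inner_prod_def)
    then have "(fst x)\<^sup>2 = (fst y)\<^sup>2" by (simp add: power2_eq_square)
    then have fe: "fst x = fst y" using x y by (simp add: power2_eq_iff_nonneg)
    have "(snd x - snd y) \<bullet> (snd x - snd y) = 0"
      using 0 f fe by (simp add: lor_def inner_simps inner_commute)
    then have "snd x = snd y" by simp
    with fe \<open>x \<noteq> y\<close> show False by (simp add: prod_eq_iff)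
  qed
qed (use assms in \<open>simp_all add: inner_add_right\<close>)

section \<open>Spherical geometry of angles between functionals\<close>

definition ang :: "real \<times> 'b::real_inner \<Rightarrow> real \<times> 'b \<Rightarrow> real" where
  "ang a b = arccos (lor a b / (sqrt (lor b b) * sqrt (lor a a)))"

lemma ang_commute: "ang a b = ang b a"
  by (simp add: ang_def lor_commute mult.commute)

text \<open>On the functionals vanishing at \<open>x\<close> the form is positive semidefinite,
  which is what Cauchy-Schwarz takes. Null functionals can occur, so \<open>lor b b = 0\<close> is a
  separate case.\<close>

lemma lor_cauchy_schwarz:
  assumes x: "x \<noteq> 0" "lor x x \<le> 0" and a: "a \<bullet> x = 0" and b: "b \<bullet> x = 0"
  shows "(lor a b)\<^sup>2 \<le> lor a a * lor b b"
proof (cases "lor b b = 0")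
  case True
  have nn: "0 \<le> lor a a + 2 * t * lor a b" for t
  proof -
    have "0 \<le> lor (a + t *\<^sub>R b) (a + t *\<^sub>R b)"
      by (rule lor_nonneg[OF x]) (simp add: inner_simps a b)
    then show ?thesis by (simp add: lor_commute True algebra_simps)
  qed
  have "lor a b = 0"
  proof (rule ccontr)
    assume "lor a b \<noteq> 0"
    \<comment> \<open>This parameter turns \<open>lor a a + 2 * t * lor a b\<close> into
      \<open>-1\<close>.\<close>
    then show False using nn[of "- (lor a a + 1) / (2 * lor a b)"] by (simp add: field_simps)
  qed
  then show ?thesis using True by simp
next
  case False
  have bb: "lor b b > 0" using lor_nonneg[OF x b] False by simp
  have "0 \<le> lor (lor b b *\<^sub>R a - lor a b *\<^sub>R b) (lor b b *\<^sub>R a - lor a b *\<^sub>R b)"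
    by (rule lor_nonneg[OF x]) (simp add: inner_simps a b)
  also have "\<dots> = lor b b * (lor a a * lor b b - (lor a b)\<^sup>2)"
    by (simp add: lor_commute power2_eq_square algebra_simps)
  finally show ?thesis using bb by (simp add: zero_le_mult_iff)
qed

lemma lor_unit: 
  assumes "0 < lor a a" 
  shows "lor ((1 / sqrt (lor a a)) *\<^sub>R a) ((1 / sqrt (lor a a)) *\<^sub>R a) = 1"
  using assms by (simp add: field_simps)

lemma lor_unit_bounds:
  assumes x: "x \<noteq> 0" "lor x x \<le> 0" and "a \<bullet> x = 0" "b \<bullet> x = 0" "lor a a = 1" "lor b b = 1"
  shows "- 1 \<le> lor a b" "lor a b \<le> 1"
proof -
  have "(lor a b)\<^sup>2 \<le> 1" using lor_cauchy_schwarz[OF assms(1-4)] assms(5,6) by simp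
  then have "\<bar>lor a b\<bar> \<le> 1" by (simp add: abs_square_le_1)
  then show "- 1 \<le> lor a b" "lor a b \<le> 1" by linarith+
qed

text \<open>Removing from \<open>a\<close> and \<open>c\<close> their components along
  \<open>b\<close> leaves vectors of squared lengths \<open>1 - p\<^sup>2\<close> and
  \<open>1 - q\<^sup>2\<close>. Cauchy-Schwarz for these two bounds \<open>lor a c\<close> below by
  the cosine of the sum of the two angles.\<close>

lemma lor_unit_triangle:
  assumes x: "x \<noteq> 0" "lor x x \<le> 0" and 0: "a \<bullet> x = 0" "b \<bullet> x = 0" "c \<bullet> x = 0"
    and 1: "lor a a = 1" "lor b b = 1" "lor c c = 1"
  shows "arccos (lor a c) \<le> arccos (lor a b) + arccos (lor b c)"
proof -
  define p q where "p = lor a b" and "q = lor b c"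
  have pq: "-1 \<le> p" "p \<le> 1" "-1 \<le> q" "q \<le> 1" and ac: "-1 \<le> lor a c" "lor a c \<le> 1"
    unfolding p_def q_def using lor_unit_bounds[OF x] 0 1 by auto
  have "(lor (a - p *\<^sub>R b) (c - q *\<^sub>R b))\<^sup>2 \<le> lor (a - p *\<^sub>R b) (a - p *\<^sub>R b) * lor (c - q *\<^sub>R b) (c - q *\<^sub>R b)"
    by (rule lor_cauchy_schwarz[OF x]) (simp_all add: inner_simps 0)
  then have "(lor a c - p * q)\<^sup>2 \<le> (1 - p\<^sup>2) * (1 - q\<^sup>2)"
    by (simp add: p_def q_def 1 lor_commute[of b a] lor_commute[of c b] power2_eq_square)
  then have "\<bar>lor a c - p * q\<bar> \<le> sqrt ((1 - p\<^sup>2) * (1 - q\<^sup>2))"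
    using real_sqrt_le_mono by fastforce
  then have "\<bar>lor a c - p * q\<bar> \<le> sin (arccos p) * sin (arccos q)"
    using pq by (simp add: sin_arccos real_sqrt_mult)
  then have *: "cos (arccos p + arccos q) \<le> lor a c"
    using pq by (simp add: cos_add)
  show ?thesis
  proof (cases "arccos p + arccos q \<le> pi")
    case True
    have "arccos (lor a c) \<le> arccos (cos (arccos p + arccos q))"
      by (rule arccos_le_arccos) (use * ac in auto)
    also have "\<dots> = arccos p + arccos q"
      by (rule arccos_cos) (use True pq arccos_lbound in \<open>auto intro!: add_nonneg_nonneg\<close>)
    finally show ?thesis by (simp add: p_def q_def)
  next
    case False
    then show ?thesis using arccos_ubound[OF ac] by (simp add: p_def q_def)
  qed
qed

text \<open>A vector \<open>b\<close> in the cone of \<open>a\<close> and \<open>c\<close> splits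
  their angle. The normalisation of \<open>b\<close> yields the sines of the two parts; their sum
  has cosine \<open>z\<close> and nonnegative sine, which identifies it with the angle
  itself.\<close>

lemma lor_unit_between:
  assumes x: "x \<noteq> 0" "lor x x \<le> 0" and 0: "a \<bullet> x = 0" "c \<bullet> x = 0"
    and 1: "lor a a = 1" "lor b b = 1" "lor c c = 1" and b: "b = r *\<^sub>R a + s *\<^sub>R c" and rs: "0 \<le> r" "0 \<le> s"
  shows "arccos (lor a b) + arccos (lor b c) \<le> arccos (lor a c)"
proof -
  define z where "z = lor a c"
  have b0: "b \<bullet> x = 0" using b 0 by (simp add: inner_simps)
  have z: "-1 \<le> z" "z \<le> 1" unfolding z_def using lor_unit_bounds[OF x] 0 1 by auto
  have ab: "lor a b = r + s * z" and bc: "lor b c = r * z + s"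
    by (simp_all add: b 1 z_def)
  have u: "r * r + 2 * r * s * z + s * s = 1"
    using 1(2) by (simp add: b 1(1,3) lor_commute[of c a] z_def algebra_simps)
  have bd: "-1 \<le> r + s * z" "r + s * z \<le> 1" "-1 \<le> r * z + s" "r * z + s \<le> 1"
    using lor_unit_bounds[OF x, of a b] lor_unit_bounds[OF x, of b c] 0 b0 1 ab bc by auto
  have z2: "0 \<le> 1 - z\<^sup>2" using z by (simp add: abs_square_le_1 abs_le_iff)
  have s1: "sin (arccos (r + s * z)) = s * sqrt (1 - z\<^sup>2)"
  proof -
    have "1 - (r + s * z)\<^sup>2 = s\<^sup>2 * (1 - z\<^sup>2)" using u by (simp add: power2_eq_square algebra_simps)
    then show ?thesis using bd rs by (simp add: sin_arccos real_sqrt_mult)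
  qed
  have s2: "sin (arccos (r * z + s)) = r * sqrt (1 - z\<^sup>2)"
  proof -
    have "1 - (r * z + s)\<^sup>2 = r\<^sup>2 * (1 - z\<^sup>2)" using u by (simp add: power2_eq_square algebra_simps)
    then show ?thesis using bd rs by (simp add: sin_arccos real_sqrt_mult)
  qed
  let ?A = "arccos (r + s * z)" and ?C = "arccos (r * z + s)"
  have q: "sqrt (1 - z\<^sup>2) * sqrt (1 - z\<^sup>2) = 1 - z\<^sup>2" using z2 by simp
  have "cos (?A + ?C) = (r + s * z) * (r * z + s) - r * s * (sqrt (1 - z\<^sup>2) * sqrt (1 - z\<^sup>2))"
    using bd by (simp add: cos_add s1 s2)
  also have "\<dots> = z * (r * r + 2 * r * s * z + s * s)"
    unfolding q by (simp add: power2_eq_square algebra_simps)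
  finally have cs: "cos (?A + ?C) = z" using u by simp
  have "sin (?A + ?C) = (s * sqrt (1 - z\<^sup>2)) * (r * z + s) + (r + s * z) * (r * sqrt (1 - z\<^sup>2))"
    unfolding sin_add s1 s2 using bd by simp
  also have "\<dots> = sqrt (1 - z\<^sup>2) * (r * r + 2 * r * s * z + s * s)"
    by (simp add: algebra_simps)
  finally have "sin (?A + ?C) = sqrt (1 - z\<^sup>2) * (r * r + 2 * r * s * z + s * s)" .
  then have sn: "0 \<le> sin (?A + ?C)" using u z2 by simp
  have A: "0 \<le> ?A" "?A \<le> pi" "0 \<le> ?C" "?C \<le> pi"
    using bd by (auto intro: arccos_lbound arccos_ubound)
  \<comment> \<open>Nonnegative sine leaves only the sum \<open>2 * pi\<close> to exclude: both
    parts would be \<open>pi\<close>, which nonnegative \<open>r\<close> and \<open>s\<close>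
    forbid.\<close>
  have "?A + ?C \<le> pi"
  proof (rule ccontr)
    assume n: "\<not> ?thesis"
    show False
    proof (cases "?A + ?C = 2 * pi")
      case True
      then have "?A = pi" "?C = pi" using A by auto
      then have "r + s * z = -1" "r * z + s = -1"
        using cos_arccos[OF bd(1,2)] cos_arccos[OF bd(3,4)] by simp_all
      moreover have "r * (r + s * z) + s * (r * z + s) = 1" using u by (simp add: algebra_simps)
      ultimately have "- r - s = 1" by simp
      then show False using rs by simp
    next
      case False
      then have "sin (?A + ?C) < 0" using A n by (intro sin_lt_zero) auto
      then show False using sn by simp
    qed
  qed
  then have "?A + ?C = arccos (cos (?A + ?C))" using A by (intro arccos_cos[symmetric]) auto
  then have "?A + ?C = arccos z" unfolding cs .
  then show ?thesis unfolding ab bc by (simp add: z_def)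
qed

lemma ang_triangle:
  assumes x: "x \<noteq> 0" "lor x x \<le> 0" and 0: "a \<bullet> x = 0" "b \<bullet> x = 0" "c \<bullet> x = 0"
    and p: "0 < lor a a" "0 < lor b b" "0 < lor c c"
  shows "ang a c \<le> ang a b + ang b c"
  unfolding ang_def
  using lor_unit_triangle[OF x _ _ _ lor_unit[OF p(1)] lor_unit[OF p(2)] lor_unit[OF p(3)]] 0
  by simp

lemma ang_between:
  assumes x: "x \<noteq> 0" "lor x x \<le> 0" and 0: "a \<bullet> x = 0" "c \<bullet> x = 0"
    and p: "0 < lor a a" "0 < lor b b" "0 < lor c c" and b: "b = r *\<^sub>R a + s *\<^sub>R c" and rs: "0 \<le> r" "0 \<le> s"
  shows "ang a b + ang b c \<le> ang a c"
proof -
  let ?u = "\<lambda>a. (1 / sqrt (lor a a)) *\<^sub>R a"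
  have "?u b = (r * sqrt (lor a a) / sqrt (lor b b)) *\<^sub>R ?u a + (s * sqrt (lor c c) / sqrt (lor b b)) *\<^sub>R ?u c"
    using p by (subst (2) b) (simp add: scaleR_right_distrib)
  from lor_unit_between[OF x _ _ lor_unit[OF p(1)] lor_unit[OF p(2)] lor_unit[OF p(3)] this]
  show ?thesis unfolding ang_def using 0 rs p by simp
qed

lemma ang_le_pi:
  assumes x: "x \<noteq> 0" "lor x x \<le> 0" and 0: "a \<bullet> x = 0" "b \<bullet> x = 0"
    and p: "0 < lor a a" "0 < lor b b"
  shows "0 \<le> ang a b" "ang a b \<le> pi"
proof -
  have "-1 \<le> lor a b / (sqrt (lor b b) * sqrt (lor a a))" "lor a b / (sqrt (lor b b) * sqrt (lor a a)) \<le> 1"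
    using lor_unit_bounds[OF x _ _ lor_unit[OF p(1)] lor_unit[OF p(2)]] 0 by simp_all
  then show "0 \<le> ang a b" "ang a b \<le> pi" unfolding ang_def by (auto intro: arccos_lbound arccos_ubound)
qed

lemma ang_ge_pi_half:
  assumes x: "x \<noteq> 0" "lor x x \<le> 0" and 0: "a \<bullet> x = 0" "b \<bullet> x = 0"
    and p: "0 < lor a a" "0 < lor b b" and n: "lor a b \<le> 0"
  shows "pi / 2 \<le> ang a b"
proof -
  have "-1 \<le> lor a b / (sqrt (lor b b) * sqrt (lor a a))"
    using lor_unit_bounds[OF x _ _ lor_unit[OF p(1)] lor_unit[OF p(2)]] 0 by simp_all
  moreover have "lor a b / (sqrt (lor b b) * sqrt (lor a a)) \<le> 0"
    using p n by (simp add: divide_nonpos_pos)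
  ultimately have "arccos 0 \<le> ang a b" unfolding ang_def by (intro arccos_le_arccos) auto
  then show ?thesis by simp
qed

section \<open>Iterated stacking in a scribed configuration\<close>

text \<open>
  \<open>deep Fam k F X\<close>: the facet \<open>F\<close> was stacked, together with all facets arising from it, for \<open>k\<close> rounds.
  The vertices added are \<open>X\<close>, and the facets left at the end belong to \<open>Fam\<close>.
\<close>

primrec deep :: "'v set set \<Rightarrow> nat \<Rightarrow> 'v set \<Rightarrow> 'v set \<Rightarrow> bool" where
  "deep Fam 0 F X \<longleftrightarrow> F \<in> Fam \<and> X = {}"
| "deep Fam (Suc k) F X \<longleftrightarrow> (\<exists>p Y. X = insert p (\<Union>f\<in>F. Y f) \<and> F \<inter> X = {} \<and>
     (\<forall>f\<in>F. deep Fam k (insert p (F - {f})) (Y f)))"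

lemma deep_SucE:
  assumes "deep Fam (Suc k) F X"
  obtains p Y where "X = insert p (\<Union>f\<in>F. Y f)" "F \<inter> X = {}"
    "\<And>f. f \<in> F \<Longrightarrow> deep Fam k (insert p (F - {f})) (Y f)"
  using assms unfolding deep.simps by blast

text \<open>A facet that has been stacked over is no longer a facet at the end, yet its proper faces
  survive: a face missing \<open>f\<close> lies in the child that replaces \<open>f\<close> by
  \<open>p\<close>. The cutting and avoiding hypotheses thus stay available for them.\<close>

lemma deep_proper_subset:
  assumes "deep Fam k F X" "S \<subset> F"
  shows "\<exists>G\<in>Fam. S \<subseteq> G"
  using assms
proof (induction k arbitrary: F X)
  case 0
  then show ?case by auto
next
  case (Suc k)
  obtain p Y where X: "X = insert p (\<Union>f\<in>F. Y f)" "F \<inter> X = {}"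
    and *: "\<And>f. f \<in> F \<Longrightarrow> deep Fam k (insert p (F - {f})) (Y f)"
    using Suc.prems(1) by (rule deep_SucE) blast
  obtain f where f: "f \<in> F" "f \<notin> S" using Suc.prems by blast
  have "p \<notin> S" using X Suc.prems by auto
  then have "S \<subset> insert p (F - {f})" using Suc.prems f by blast
  then show ?case using Suc.IH * f by blast
qed

lemma deep_mono:
  assumes "deep Fam k F X" "Fam \<subseteq> Fam'"
  shows "deep Fam' k F X"
  using assms(1)
proof (induction k arbitrary: F X)
  case 0
  then show ?case using assms(2) by auto
next
  case (Suc k)
  obtain p Y where "X = insert p (\<Union>f\<in>F. Y f)" "F \<inter> X = {}"
    "\<And>f. f \<in> F \<Longrightarrow> deep Fam k (insert p (F - {f})) (Y f)"
    using Suc.prems by (rule deep_SucE) blast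
  with Suc.IH show ?case unfolding deep.simps by blast
qed

section \<open>Linear independence of indexed families\<close>

lemma independent_family:
  fixes \<phi> :: "'v \<Rightarrow> 'b::real_vector"
  assumes fin: "finite S" and zero: "\<And>u v. (\<Sum>v\<in>S. u v *\<^sub>R \<phi> v) = 0 \<Longrightarrow> v \<in> S \<Longrightarrow> u v = 0"
  shows "inj_on \<phi> S" "independent (\<phi> ` S)"
proof -
  show inj: "inj_on \<phi> S"
  proof (rule inj_onI, rule ccontr)
    fix a b assume ab: "a \<in> S" "b \<in> S" "\<phi> a = \<phi> b" "a \<noteq> b"
    \<comment> \<open>If two indices had the same vector, the coefficients \<open>1\<close> and
      \<open>-1\<close> there would be a nontrivial relation.\<close>
    have "(\<Sum>v\<in>S. (if v = a then 1 else if v = b then -1 else 0) *\<^sub>R \<phi> v)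
        = (\<Sum>v\<in>S. (if v = a then \<phi> a else 0) - (if v = b then \<phi> b else 0))"
      by (rule sum.cong) (use ab in auto)
    also have "\<dots> = 0" using ab fin by (simp add: sum_subtractf)
    finally show False using zero[of "\<lambda>v. if v = a then 1 else if v = b then -1 else 0" a] ab by simp
  qed
  show "independent (\<phi> ` S)"
  proof (rule ccontr)
    assume "\<not> independent (\<phi> ` S)"
    then obtain u v where s: "(\<Sum>v\<in>\<phi> ` S. u v *\<^sub>R v) = 0" and v: "v \<in> S" "u (\<phi> v) \<noteq> 0"
      using dependent_finite[of "\<phi> ` S"] fin by blast
    have "(\<Sum>v\<in>S. u (\<phi> v) *\<^sub>R \<phi> v) = 0"
      using s by (simp only: sum.reindex[OF inj] o_def)
    then have "u (\<phi> v) = 0" using v(1) by (rule zero)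
    then show False using v(2) by simp
  qed
qed

lemma card_exchange:
  assumes "finite F" "f \<in> F" "p \<notin> F"
  shows "card (insert p (F - {f})) = card F"
proof -
  have "card (insert p (F - {f})) = Suc (card (F - {f}))" using assms by (intro card_insert_disjoint) auto
  also have "\<dots> = card F" using assms by (intro card_Suc_Diff1)
  finally show ?thesis .
qed

text \<open>What the angle estimate uses of a scribed realization. \<open>\<phi> v\<close>
  represents the vertex \<open>v\<close>, \<open>Fam\<close> the simplex facets, and a face is
  certified by a functional that is nonpositive on all vertices and zero exactly on the face. A
  \<open>k\<close>-face of a simplex has \<open>k + 1\<close> vertices, so \<open>i + 1\<close>
  vertices avoid and \<open>i + 2\<close> vertices cut. \<open>x S\<close> is the cutting point,
  placed in the span of its face by the last condition of \<open>cut\<close>.\<close>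

locale scribed_config =
  fixes \<phi> :: "'v \<Rightarrow> real \<times> 'b::euclidean_space" and V :: "'v set" and Fam :: "'v set set"
    and T :: "'v set" and i d :: nat and x :: "'v set \<Rightarrow> real \<times> 'b"
  assumes fin: "finite V" and dim: "DIM('b) = d" and id: "i + 4 \<le> d"
    and T: "finite T" "card T = i"
    and nz: "v \<in> V \<Longrightarrow> \<phi> v \<noteq> 0"
    and fam: "G \<in> Fam \<Longrightarrow> \<exists>n. \<forall>v\<in>V. n \<bullet> \<phi> v \<le> 0 \<and> (n \<bullet> \<phi> v = 0 \<longleftrightarrow> v \<in> G)"
    and vertex: "w \<in> V \<Longrightarrow> \<exists>n. \<forall>v\<in>V. n \<bullet> \<phi> v \<le> 0 \<and> (n \<bullet> \<phi> v = 0 \<longleftrightarrow> v = w)"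
    and avoid: "S \<subseteq> G \<Longrightarrow> G \<in> Fam \<Longrightarrow> card S = i + 1 \<Longrightarrow>
      \<exists>n. lor n n \<le> 0 \<and> (\<forall>v\<in>V. n \<bullet> \<phi> v \<le> 0 \<and> (n \<bullet> \<phi> v = 0 \<longleftrightarrow> v \<in> S))"
    and cut: "S \<subseteq> G \<Longrightarrow> G \<in> Fam \<Longrightarrow> card S = i + 2 \<Longrightarrow>
      norm (x S) = 1 \<and> 0 \<le> fst (x S) \<and> lor (x S) (x S) \<le> 0 \<and>
      (\<forall>n. (\<forall>s\<in>S. n \<bullet> \<phi> s = 0) \<longrightarrow> n \<bullet> x S = 0)"
    and cut_inj: "S \<subseteq> G \<Longrightarrow> G \<in> Fam \<Longrightarrow> card S = i + 2 \<Longrightarrow>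
      S' \<subseteq> G' \<Longrightarrow> G' \<in> Fam \<Longrightarrow> card S' = i + 2 \<Longrightarrow> S \<noteq> S' \<Longrightarrow> x S \<noteq> x S'"
begin

definition vanishes :: "real \<times> 'b \<Rightarrow> 'v set \<Rightarrow> bool" where
  "vanishes n S \<longleftrightarrow> (\<forall>v\<in>S. n \<bullet> \<phi> v = 0)"

definition negative :: "real \<times> 'b \<Rightarrow> 'v set \<Rightarrow> bool" where
  "negative n S \<longleftrightarrow> (\<forall>v\<in>S. n \<bullet> \<phi> v < 0)"

text \<open>For a ridge \<open>R\<close> these are the positions of a supporting hyperplane rotating
  about \<open>R\<close>; \<open>between\<close> orders them around the ridge.\<close>

definition supports :: "real \<times> 'b \<Rightarrow> 'v set \<Rightarrow> bool" where
  "supports l R \<longleftrightarrow> l \<noteq> 0 \<and> vanishes l R \<and> (\<forall>v\<in>V. l \<bullet> \<phi> v \<le> 0)"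

definition between :: "real \<times> 'b \<Rightarrow> real \<times> 'b \<Rightarrow> real \<times> 'b \<Rightarrow> bool" where
  "between a b c \<longleftrightarrow> (\<exists>r s. 0 \<le> r \<and> 0 \<le> s \<and> b = r *\<^sub>R a + s *\<^sub>R c)"

lemma finite_card: "card F = d \<Longrightarrow> finite F"
  using id by (intro card_ge_0_finite) simp

lemma between_trans:
  assumes "between n a l" "between a m l"
  shows "between n m l"
proof -
  obtain r s where 1: "0 \<le> r" "0 \<le> s" "a = r *\<^sub>R n + s *\<^sub>R l" using assms(1) by (auto simp: between_def)
  obtain r' s' where 2: "0 \<le> r'" "0 \<le> s'" "m = r' *\<^sub>R a + s' *\<^sub>R l" using assms(2) by (auto simp: between_def)
  have "m = (r' * r) *\<^sub>R n + (r' * s + s') *\<^sub>R l" by (simp add: 1 2 algebra_simps)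
  then show ?thesis unfolding between_def using 1 2 by (intro exI[of _ "r' * r"] exI[of _ "r' * s + s'"]) auto
qed

text \<open>Two vertices added to \<open>T\<close> give a face that cuts. Its cutting point is a
  common zero, in the light cone, of all functionals vanishing on \<open>U\<close>, and serves as
  the base point of the angle lemmas.\<close>

lemma psd_point:
  assumes "T \<subseteq> U" "U \<subseteq> G" "G \<in> Fam" "finite U" "i + 2 \<le> card U"
  obtains y where "y \<noteq> 0" "lor y y \<le> 0" "\<And>l. vanishes l U \<Longrightarrow> l \<bullet> y = 0"
proof -
  have "2 \<le> card (U - T)" using assms T by (simp add: card_Diff_subset)
  then obtain W where W: "W \<subseteq> U - T" "card W = 2" "finite W" by (metis obtain_subset_with_card_n)
  have c: "card (T \<union> W) = i + 2" using W T by (subst card_Un_disjoint) auto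
  have s: "T \<union> W \<subseteq> G" using W assms by auto
  note ct = cut[OF s assms(3) c]
  show ?thesis
  proof (rule that[of "x (T \<union> W)"])
    show "x (T \<union> W) \<noteq> 0" using ct by auto
    show "l \<bullet> x (T \<union> W) = 0" if "vanishes l U" for l
      using ct that W assms(1) unfolding vanishes_def by blast
  qed (use ct in auto)
qed

text \<open>Three vertices beyond \<open>T\<close> give two cutting faces
  \<open>T \<union> {u,v}\<close> and \<open>T \<union> {u,w}\<close> with different cutting points,
  and two distinct zeros in the cap make the form strictly positive.\<close>

lemma spacelike:
  assumes "T \<subseteq> R" "R \<subseteq> G" "G \<in> Fam" "finite R" "i + 3 \<le> card R" "l \<noteq> 0" "vanishes l R"
  shows "0 < lor l l"
proof -
  have "3 \<le> card (R - T)" using assms T by (simp add: card_Diff_subset)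
  then obtain W where W: "W \<subseteq> R - T" "card W = 3" by (metis obtain_subset_with_card_n)
  then obtain u v w where uvw: "W = {u,v,w}" "u \<noteq> v" "u \<noteq> w" "v \<noteq> w" by (auto simp: card_3_iff)
  have n: "u \<notin> T" "v \<notin> T" "w \<notin> T" "u \<in> R" "v \<in> R" "w \<in> R" using W uvw by auto
  have c: "card (T \<union> {u,v}) = i + 2" "card (T \<union> {u,w}) = i + 2"
    using T uvw n by (auto simp: card_Un_disjoint)
  have s: "T \<union> {u,v} \<subseteq> G" "T \<union> {u,w} \<subseteq> G" using n assms by auto
  have ne: "T \<union> {u,v} \<noteq> T \<union> {u,w}" using uvw n by auto
  note c1 = cut[OF s(1) assms(3) c(1)] and c2 = cut[OF s(2) assms(3) c(2)]
  have "l \<bullet> x (T \<union> {u,v}) = 0" "l \<bullet> x (T \<union> {u,w}) = 0"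
    using c1 c2 assms(1,7) n unfolding vanishes_def by blast+
  then show ?thesis
    using lor_pos_of_two[of "x (T \<union> {u,v})" "x (T \<union> {u,w})" l] c1 c2 assms(6)
      cut_inj[OF s(1) assms(3) c(1) s(2) assms(3) c(2) ne] by blast
qed

text \<open>The \<open>N f\<close> act as a dual family: each isolates the coefficient at
  \<open>f\<close>, and \<open>\<phi> p \<noteq> 0\<close> settles the last one. The
  \<open>d + 1\<close> vectors are thus a basis, so functionals can be compared by their values on
  \<open>insert p F\<close>.\<close>

lemma simplex_basis:
  assumes F: "card F = d" "p \<notin> F" "\<phi> p \<noteq> 0"
    and N: "\<And>f. f \<in> F \<Longrightarrow> vanishes (N f) (insert p (F - {f})) \<and> N f \<bullet> \<phi> f < 0"
  shows simplex_functional_eq: "\<And>a b. (\<And>v. v \<in> insert p F \<Longrightarrow> a \<bullet> \<phi> v = b \<bullet> \<phi> v) \<Longrightarrow> a = b"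
    and simplex_expansion: "\<And>w. \<exists>c. w = (\<Sum>v\<in>insert p F. c v *\<^sub>R \<phi> v)"
proof -
  have finF: "finite F" using F(1) by (rule finite_card)
  have zero: "u v = 0" if "(\<Sum>v\<in>insert p F. u v *\<^sub>R \<phi> v) = 0" "v \<in> insert p F" for u v
  proof -
    have uf: "u f = 0" if f: "f \<in> F" for f
    proof -
      have "0 = N f \<bullet> (\<Sum>v\<in>insert p F. u v *\<^sub>R \<phi> v)" using \<open>_ = 0\<close> by simp
      also have "\<dots> = (\<Sum>v\<in>insert p F. u v * (N f \<bullet> \<phi> v))" by (simp add: inner_sum_right)
      also have "\<dots> = (\<Sum>v\<in>insert p F. if v = f then u f * (N f \<bullet> \<phi> f) else 0)"
        by (rule sum.cong) (use N[OF f] in \<open>auto simp: vanishes_def\<close>)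
      also have "\<dots> = u f * (N f \<bullet> \<phi> f)" using finF f by simp
      finally show ?thesis using N[OF f] by auto
    qed
    moreover have "u p = 0"
    proof -
      have "(\<Sum>v\<in>insert p F. u v *\<^sub>R \<phi> v) = u p *\<^sub>R \<phi> p"
        using finF F(2) uf by simp
      then show ?thesis using that(1) F(3) by simp
    qed
    ultimately show ?thesis using that(2) by auto
  qed
  have finpF: "finite (insert p F)" using finF by simp
  have inj: "inj_on \<phi> (insert p F)" and ind: "independent (\<phi> ` insert p F)"
    by (rule independent_family[OF finpF], erule (1) zero)+
  have "card (\<phi> ` insert p F) = d + 1" using card_image[OF inj] F finF by simp
  then have sp: "span (\<phi> ` insert p F) = UNIV"
    using card_ge_dim_independent[of "\<phi> ` insert p F" UNIV] ind dim by auto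
  show "\<exists>c. w = (\<Sum>v\<in>insert p F. c v *\<^sub>R \<phi> v)" for w
  proof -
    have "w \<in> range (\<lambda>u. \<Sum>v\<in>\<phi> ` insert p F. u v *\<^sub>R v)"
      using sp finF by (subst span_finite[symmetric]) auto
    then obtain u where "w = (\<Sum>v\<in>\<phi> ` insert p F. u v *\<^sub>R v)" by auto
    then have "w = (\<Sum>v\<in>insert p F. u (\<phi> v) *\<^sub>R \<phi> v)" by (simp only: sum.reindex[OF inj] o_def)
    then show ?thesis by (intro exI[of _ "\<lambda>v. u (\<phi> v)"])
  qed
  then show "a = b" if ab: "\<And>v. v \<in> insert p F \<Longrightarrow> a \<bullet> \<phi> v = b \<bullet> \<phi> v" for a b
  proof -
    obtain c where "a - b = (\<Sum>v\<in>insert p F. c v *\<^sub>R \<phi> v)"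
      using \<open>\<And>w. \<exists>c. w = (\<Sum>v\<in>insert p F. c v *\<^sub>R \<phi> v)\<close> by blast
    then have "(a - b) \<bullet> (a - b) = (\<Sum>v\<in>insert p F. c v * ((a - b) \<bullet> \<phi> v))"
      by (simp add: inner_sum_right)
    also have "\<dots> = 0" using ab by (intro sum.neutral) (auto simp: inner_diff_left)
    finally show ?thesis by simp
  qed
qed

section \<open>Normals of facets that have been stacked over\<close>

text \<open>In the basis given by \<open>insert p F\<close>, a remaining vertex \<open>w\<close> has
  positive coefficients on \<open>F\<close>, because each \<open>N f\<close> is negative on
  \<open>w\<close>. Its coefficient at \<open>p\<close> is then negative, since otherwise
  \<open>w\<close> would be a nonnegative combination of other vertices. So \<open>w\<close> and
  \<open>p\<close> lie on opposite sides of the hyperplane of \<open>F\<close>.\<close>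

lemma node_support:
  assumes F: "card F = d" "F \<subseteq> V" and p: "p \<in> V" "p \<notin> F"
    and N: "\<And>f. f \<in> F \<Longrightarrow> vanishes (N f) (insert p (F - {f})) \<and> N f \<bullet> \<phi> f < 0"
    and W: "W \<subseteq> V" "p \<notin> W" "W \<inter> F = {}" "\<And>f. f \<in> F \<Longrightarrow> negative (N f) W"
  shows "\<exists>n. vanishes n F \<and> 0 < n \<bullet> \<phi> p \<and> negative n W"
proof -
  have finF: "finite F" using F(1) by (rule finite_card)
  have F0: "F \<noteq> {}" using F(1) id by auto
  have "dim (\<phi> ` F) \<le> card (\<phi> ` F)" using finF by (simp add: dim_le_card')
  also have "\<dots> \<le> d" using card_image_le[OF finF] F by metis
  also have "\<dots> < DIM(real \<times> 'b)" using dim by simp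
  finally obtain n0 where n0: "n0 \<noteq> 0" "\<And>y. y \<in> span (\<phi> ` F) \<Longrightarrow> orthogonal n0 y"
    using orthogonal_to_subspace_exists by metis
  have v0: "vanishes n0 F" unfolding vanishes_def using n0(2) by (auto simp: orthogonal_def span_base)
  have np: "n0 \<bullet> \<phi> p \<noteq> 0"
  proof
    assume "n0 \<bullet> \<phi> p = 0"
    then have "n0 = 0" using v0
      by (intro simplex_functional_eq[OF F(1) p(2) nz[OF p(1)] N]) (auto simp: vanishes_def)
    then show False using n0 by simp
  qed
  \<comment> \<open>The sign is chosen so that \<open>p\<close> is on the positive side.\<close>
  define n where "n = sgn (n0 \<bullet> \<phi> p) *\<^sub>R n0"
  have v: "vanishes n F" using v0 by (simp add: n_def vanishes_def)
  have pos: "0 < n \<bullet> \<phi> p" using np by (simp add: n_def sgn_mult_self_eq[symmetric] sgn_if)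
  have "n \<bullet> \<phi> w < 0" if w: "w \<in> W" for w
  proof -
    obtain c where c: "\<phi> w = (\<Sum>v\<in>insert p F. c v *\<^sub>R \<phi> v)"
      using simplex_expansion[OF F(1) p(2) nz[OF p(1)] N] by blast
    have ev: "a \<bullet> \<phi> w = c p * (a \<bullet> \<phi> p) + (\<Sum>f\<in>F. c f * (a \<bullet> \<phi> f))" for a
      using finF p(2) by (simp add: c inner_sum_right inner_add_right)
    have cf: "0 < c f" if f: "f \<in> F" for f
    proof -
      have "N f \<bullet> \<phi> w = c p * (N f \<bullet> \<phi> p) + (\<Sum>g\<in>F. if g = f then c f * (N f \<bullet> \<phi> f) else 0)"
        unfolding ev by (intro arg_cong2[where f = "(+)"] sum.cong) (use N[OF f] in \<open>auto simp: vanishes_def\<close>)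
      also have "\<dots> = c f * (N f \<bullet> \<phi> f)" using finF f N[OF f] by (simp add: vanishes_def)
      finally have "c f * (N f \<bullet> \<phi> f) < 0" using W(4)[OF f] w by (auto simp: negative_def)
      then show ?thesis using N[OF f] by (simp add: mult_less_0_iff)
    qed
    have nw: "n \<bullet> \<phi> w = c p * (n \<bullet> \<phi> p)"
      unfolding ev using v by (simp add: vanishes_def)
    have "c p < 0"
    proof (rule ccontr)
      assume "\<not> c p < 0"
      obtain a where a: "\<forall>v\<in>V. a \<bullet> \<phi> v \<le> 0 \<and> (a \<bullet> \<phi> v = 0 \<longleftrightarrow> v = w)"
        using vertex w W by blast
      have negative: "a \<bullet> \<phi> f < 0" if "f \<in> F" for f
      proof -
        have "f \<in> V" "f \<noteq> w" using that F W w by auto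
        then show ?thesis using a by (meson order_le_imp_less_or_eq)
      qed
      have "0 = a \<bullet> \<phi> w" using a w W by auto
      also have "\<dots> = c p * (a \<bullet> \<phi> p) + (\<Sum>f\<in>F. c f * (a \<bullet> \<phi> f))" by (rule ev)
      also have "\<dots> < 0"
      proof (rule add_nonpos_neg)
        show "c p * (a \<bullet> \<phi> p) \<le> 0" using \<open>\<not> c p < 0\<close> a p by (simp add: mult_nonneg_nonpos)
        show "(\<Sum>f\<in>F. c f * (a \<bullet> \<phi> f)) < 0"
          using finF F0 cf negative by (intro sum_strict_mono[of F _ "\<lambda>_. 0", simplified]) (auto simp: mult_pos_neg)
      qed
      finally show False by simp
    qed
    then show ?thesis using nw pos by (simp add: mult_neg_pos)
  qed
  then show ?thesis using v pos unfolding negative_def by blast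
qed

text \<open>Normals are built from the leaves upward: final facets have them by hypothesis, and
  \<open>node_support\<close> combines those of the children. The vertices in \<open>X\<close>,
  added beyond \<open>F\<close>, are exempt.\<close>

lemma deep_support:
  assumes "deep Fam k F X" "F \<subseteq> V" "X \<subseteq> V" "card F = d"
  shows "\<exists>n. vanishes n F \<and> negative n (V - (F \<union> X))"
  using assms
proof (induction k arbitrary: F X)
  case 0
  then have "F \<in> Fam" "X = {}" by simp_all
  then obtain n where "\<forall>v\<in>V. n \<bullet> \<phi> v \<le> 0 \<and> (n \<bullet> \<phi> v = 0 \<longleftrightarrow> v \<in> F)" using fam[of F] by blast
  with \<open>X = {}\<close> 0(2) show ?case by (intro exI[of _ n]) (auto simp: vanishes_def negative_def less_le)
next
  case (Suc k)
  obtain p Y where X: "X = insert p (\<Union>f\<in>F. Y f)" "F \<inter> X = {}"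
    and *: "\<And>f. f \<in> F \<Longrightarrow> deep Fam k (insert p (F - {f})) (Y f)"
    using Suc.prems(1) by (rule deep_SucE) blast
  have "\<forall>f\<in>F. \<exists>n. vanishes n (insert p (F - {f})) \<and> negative n (V - (insert p (F - {f}) \<union> Y f))"
  proof
    fix f assume f: "f \<in> F"
    have "card (insert p (F - {f})) = d"
    proof -
      have "finite F" "p \<notin> F" using Suc.prems(4) finite_card X by auto
      then show ?thesis using card_exchange[of F f p] f Suc.prems(4) by simp
    qed
    moreover have "insert p (F - {f}) \<subseteq> V" "Y f \<subseteq> V" using X f Suc.prems by auto
    ultimately show "\<exists>n. vanishes n (insert p (F - {f})) \<and> negative n (V - (insert p (F - {f}) \<union> Y f))"
      using Suc.IH[OF *[OF f]] by blast
  qed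
  then obtain N where N: "\<And>f. f \<in> F \<Longrightarrow> vanishes (N f) (insert p (F - {f}))"
      "\<And>f. f \<in> F \<Longrightarrow> negative (N f) (V - (insert p (F - {f}) \<union> Y f))" by metis
  have "\<exists>n. vanishes n F \<and> 0 < n \<bullet> \<phi> p \<and> negative n (V - (F \<union> X))"
  proof (rule node_support)
    show "vanishes (N f) (insert p (F - {f})) \<and> N f \<bullet> \<phi> f < 0" if "f \<in> F" for f
      using N[OF that] that X Suc.prems by (auto simp: negative_def)
    show "negative (N f) (V - (F \<union> X))" if "f \<in> F" for f
      using N[OF that] that X by (auto simp: negative_def)
  qed (use X Suc.prems in auto)
  then show ?case by blast
qed

section \<open>Exponential growth of the total angle\<close>

text \<open>Here \<open>m f\<close> is the normal of the final facet behind the ridge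
  \<open>F - {f}\<close>, described as the first supporting functional met on rotating
  \<open>n\<close> about that ridge: every other one \<open>l\<close> lies further on. In this form
  the claim passes from the children to the parent. The vertex \<open>w\<close> outside
  \<open>F \<union> X\<close> fixes the sign of normals. The bound is zero for an untouched facet
  and \<open>pi / 2\<close> after one round; only later rounds contribute a factor, hence the
  exponent \<open>k - 1\<close>.\<close>

lemma deep_ang_bound:
  assumes "deep Fam k F X" "F \<subseteq> V" "X \<subseteq> V" "card F = d" "T \<subseteq> F" "w \<in> V" "w \<notin> F \<union> X"
    and "vanishes n F" "negative n (V - (F \<union> X))"
  shows "\<exists>m. (\<forall>f\<in>F - T. supports (m f) (F - {f}) \<and> (\<forall>l. supports l (F - {f}) \<longrightarrow> between n (m f) l)) \<and>
    (if k = 0 then 0 else pi / 2 * (real (d - i) / real (d - i - 1)) ^ (k - 1)) \<le> (\<Sum>f\<in>F - T. ang n (m f))"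
  using assms
proof (induction k arbitrary: F X n)
  case 0
  have FF: "F \<in> Fam" "X = {}" using 0(1) by simp_all
  have finF: "finite F" using 0(4) by (rule finite_card)
  have nV: "\<forall>v\<in>V. n \<bullet> \<phi> v \<le> 0"
    using 0 FF unfolding vanishes_def negative_def by (metis DiffI Un_empty_right order_less_imp_le order_refl)
  have "n \<noteq> 0" using 0 unfolding negative_def by auto
  have s: "supports n (F - {f})" for f using \<open>n \<noteq> 0\<close> nV 0(8) by (auto simp: supports_def vanishes_def)
  have b: "between n n l" for l unfolding between_def by (intro exI[of _ 1] exI[of _ 0]) simp
  have sp: "0 < lor n n"
    using spacelike[of F F n] 0 FF finF id \<open>n \<noteq> 0\<close> by auto
  obtain y where y: "y \<noteq> 0" "lor y y \<le> 0" "\<And>l. vanishes l F \<Longrightarrow> l \<bullet> y = 0"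
    using psd_point[of F F] 0 FF finF id by auto
  have "0 \<le> ang n n" using ang_le_pi(1)[OF y(1,2) _ _ sp sp] y(3) 0 by blast
  then have "0 \<le> (\<Sum>f\<in>F - T. ang n n)" by (simp add: sum_nonneg)
  \<comment> \<open>A final facet supports at its own ridges, so \<open>m f = n\<close>.\<close>
  then show ?case using s b by (intro exI[of _ "\<lambda>_. n"]) simp
next
  case (Suc k)
  obtain p Y where X: "X = insert p (\<Union>f\<in>F. Y f)" "F \<inter> X = {}"
    and *: "\<And>f. f \<in> F \<Longrightarrow> deep Fam k (insert p (F - {f})) (Y f)"
    using Suc.prems(1) by (rule deep_SucE) blast
  note FV = Suc.prems(2) and XV = Suc.prems(3) and cF = Suc.prems(4) and TF = Suc.prems(5)
    and w = Suc.prems(6,7) and vn = Suc.prems(8) and nn = Suc.prems(9)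
  have finF: "finite F" using cF by (rule finite_card)
  have p: "p \<notin> F" "p \<in> V" using X XV by auto
  have dpT: "p \<notin> T" using p TF by auto
  define D where "D = d - i"
  have D4: "4 \<le> D" using id by (simp add: D_def)
  define A where "A = F - T"
  have A: "finite A" "card A = D" "A \<subseteq> F"
    using finF cF T TF by (simp_all add: A_def D_def card_Diff_subset)
  let ?C = "\<lambda>f. insert p (F - {f})"
  have cC: "card (?C f) = d" if "f \<in> F" for f
    using card_exchange[of F f p] that finF cF p by simp
  have CV: "?C f \<subseteq> V" "Y f \<subseteq> V" "?C f \<union> Y f \<subseteq> F \<union> X" if "f \<in> F" for f
    using that FV XV X p by auto
  have "\<forall>f\<in>F. \<exists>n. vanishes n (?C f) \<and> negative n (V - (?C f \<union> Y f))"
    using deep_support[OF *] CV cC by blast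
  then obtain N where N: "\<And>f. f \<in> F \<Longrightarrow> vanishes (N f) (?C f)"
      "\<And>f. f \<in> F \<Longrightarrow> negative (N f) (V - (?C f \<union> Y f))" by metis
  have Nf: "N f \<bullet> \<phi> f < 0" if "f \<in> F" for f
    using N(2)[OF that] that X FV p by (auto simp: negative_def)
  have N': "vanishes (N f) (insert p (F - {f})) \<and> N f \<bullet> \<phi> f < 0" if "f \<in> F" for f
    using N(1) Nf that by blast
  have N0: "N f \<noteq> 0" if "f \<in> F" for f using Nf[OF that] by auto
  note eq = simplex_functional_eq[OF cF p(1) nz[OF p(2)] N']
  \<comment> \<open>\<open>n\<close> is an arbitrary normal of \<open>F\<close>, whereas
    \<open>node_support\<close> yields one that is positive at \<open>p\<close>. The two are
    proportional as both vanish on \<open>F\<close>, and negativity at \<open>w\<close> makes the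
    factor positive.\<close>
  have np: "0 < n \<bullet> \<phi> p"
  proof -
    have "\<exists>n. vanishes n F \<and> 0 < n \<bullet> \<phi> p \<and> negative n (V - (F \<union> X))"
    proof (rule node_support[OF cF FV p(2,1) N'])
      show "negative (N f) (V - (F \<union> X))" if "f \<in> F" for f
        using N(2)[OF that] that X by (auto simp: negative_def)
    qed (use X in auto)
    then obtain n' where n': "vanishes n' F" "0 < n' \<bullet> \<phi> p" "negative n' (V - (F \<union> X))" by blast
    define c where "c = (n \<bullet> \<phi> p) / (n' \<bullet> \<phi> p)"
    have "n = c *\<^sub>R n'"
      by (rule eq) (use vn n' in \<open>auto simp: vanishes_def c_def\<close>)
    moreover have "n \<bullet> \<phi> w < 0" "n' \<bullet> \<phi> w < 0" using nn n' w by (auto simp: negative_def)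
    ultimately have "0 < c" by (simp add: mult_less_0_iff)
    then show ?thesis using n' by (simp add: c_def zero_less_divide_iff)
  qed
  have n0: "n \<noteq> 0" using np by auto
  \<comment> \<open>Functionals vanishing on \<open>F - {f}\<close> are determined by their values
    at \<open>f\<close> and \<open>p\<close>; matching these two values gives the coefficients
    \<open>r\<close> and \<open>s\<close>.\<close>
  have betw: "between n (N f) l" if f: "f \<in> F" and l: "supports l (F - {f})" for f l
  proof -
    have lV: "l \<bullet> \<phi> f \<le> 0" "l \<bullet> \<phi> p \<le> 0" "l \<bullet> \<phi> w \<le> 0" using l f FV p w by (auto simp: supports_def)
    have lv: "l \<bullet> \<phi> g = 0" if "g \<in> F" "g \<noteq> f" for g using l that by (auto simp: supports_def vanishes_def)
    \<comment> \<open>With value zero at \<open>f\<close>, \<open>l\<close> would be a negative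
      multiple of \<open>n\<close> and so positive at \<open>w\<close>.\<close>
    have lf: "l \<bullet> \<phi> f < 0"
    proof (rule ccontr)
      assume "\<not> l \<bullet> \<phi> f < 0"
      then have 0: "l \<bullet> \<phi> f = 0" using lV by simp
      have lF: "\<forall>v\<in>F. l \<bullet> \<phi> v = 0" using lv 0 by metis
      define c where "c = (l \<bullet> \<phi> p) / (n \<bullet> \<phi> p)"
      have lc: "l = c *\<^sub>R n"
        by (rule eq) (use vn lF np in \<open>auto simp: vanishes_def c_def\<close>)
      have "c \<le> 0" using lV np by (simp add: c_def divide_nonpos_pos)
      moreover have "c \<noteq> 0" using lc l by (auto simp: supports_def)
      ultimately have "c < 0" by simp
      moreover have "n \<bullet> \<phi> w < 0" using nn w by (auto simp: negative_def)
      ultimately have "0 < l \<bullet> \<phi> w" by (simp add: lc mult_neg_neg)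
      then show False using lV by simp
    qed
    define s where "s = (N f \<bullet> \<phi> f) / (l \<bullet> \<phi> f)"
    define r where "r = - (s * (l \<bullet> \<phi> p)) / (n \<bullet> \<phi> p)"
    have "0 \<le> s" using Nf[OF f] lf by (simp add: s_def divide_nonpos_nonpos)
    moreover from this have "0 \<le> r" using lV np mult_nonneg_nonpos[of s "l \<bullet> \<phi> p"] by (simp add: r_def divide_nonpos_pos)
    moreover have "N f = r *\<^sub>R n + s *\<^sub>R l"
    proof (rule eq)
      fix v assume v: "v \<in> insert p F"
      show "N f \<bullet> \<phi> v = (r *\<^sub>R n + s *\<^sub>R l) \<bullet> \<phi> v"
      proof (cases "v = p")
        case True
        then show ?thesis using N(1)[OF f] np by (simp add: vanishes_def inner_simps r_def)
      next
        case False
        then have "v \<in> F" using v by simp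
        then show ?thesis using N(1)[OF f] vn lf lv False
          by (cases "v = f") (auto simp: vanishes_def inner_simps s_def)
      qed
    qed
    ultimately show ?thesis unfolding between_def by blast
  qed
  have "\<forall>f\<in>A. \<exists>m. (\<forall>g\<in>?C f - T. supports (m g) (?C f - {g}) \<and> (\<forall>l. supports l (?C f - {g}) \<longrightarrow> between (N f) (m g) l)) \<and>
    (if k = 0 then 0 else pi / 2 * (real (d - i) / real (d - i - 1)) ^ (k - 1)) \<le> (\<Sum>g\<in>?C f - T. ang (N f) (m g))"
  proof
    fix f assume f: "f \<in> A"
    then have fF: "f \<in> F" using A by blast
    have "T \<subseteq> ?C f" using TF f by (auto simp: A_def)
    moreover have "w \<notin> ?C f \<union> Y f" using w CV[OF fF] by blast
    ultimately show "\<exists>m. (\<forall>g\<in>?C f - T. supports (m g) (?C f - {g}) \<and> (\<forall>l. supports l (?C f - {g}) \<longrightarrow> between (N f) (m g) l)) \<and>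
    (if k = 0 then 0 else pi / 2 * (real (d - i) / real (d - i - 1)) ^ (k - 1)) \<le> (\<Sum>g\<in>?C f - T. ang (N f) (m g))"
      using Suc.IH[OF *[OF fF] CV(1,2)[OF fF] cC[OF fF] _ w(1) _ N[OF fF]] by blast
  qed
  then obtain M where M0: "\<And>f. f \<in> A \<Longrightarrow> (\<forall>g\<in>?C f - T. supports (M f g) (?C f - {g}) \<and> (\<forall>l. supports l (?C f - {g}) \<longrightarrow> between (N f) (M f g) l)) \<and>
    (if k = 0 then 0 else pi / 2 * (real (d - i) / real (d - i - 1)) ^ (k - 1)) \<le> (\<Sum>g\<in>?C f - T. ang (N f) (M f g))"
    by metis
  define L where "L = (if k = 0 then 0 else pi / 2 * (real (d - i) / real (d - i - 1)) ^ (k - 1))"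
  have CT: "?C f - T = insert p (A - {f})" for f using dpT by (auto simp: A_def)
  have child_sum: "L \<le> ang (N f) (M f p) + (\<Sum>g\<in>A - {f}. ang (N f) (M f g))" if "f \<in> A" for f
  proof -
    have "L \<le> (\<Sum>g\<in>insert p (A - {f}). ang (N f) (M f g))"
      using M0[OF that] unfolding CT L_def by blast
    moreover have "p \<notin> A - {f}" "finite (A - {f})" using A p by auto
    ultimately show ?thesis by simp
  qed
  \<comment> \<open>Dropping \<open>p\<close> from a child returns a ridge of \<open>F\<close>, so
    \<open>M f p\<close> is the normal wanted for the parent.\<close>
  have Mp: "supports (M f p) (F - {f})" "\<And>l. supports l (F - {f}) \<Longrightarrow> between (N f) (M f p) l" if "f \<in> A" for f
  proof -
    have "?C f - {p} = F - {f}" using p by auto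
    then show "supports (M f p) (F - {f})" "\<And>l. supports l (F - {f}) \<Longrightarrow> between (N f) (M f p) l"
      using M0[OF that] unfolding CT by (metis insertI1)+
  qed
  \<comment> \<open>The ridge \<open>?R f g\<close> is common to the children of \<open>f\<close>
    and \<open>g\<close>, so its angle has to accommodate the contributions of both.\<close>
  let ?R = "\<lambda>f g. insert p (F - {f, g})"
  have Mg: "supports (M f g) (?R f g)" "\<And>l. supports l (?R f g) \<Longrightarrow> between (N f) (M f g) l"
    if "f \<in> A" "g \<in> A" "f \<noteq> g" for f g
  proof -
    have "?C f - {g} = ?R f g" using p that A by auto
    moreover have "g \<in> ?C f - T" unfolding CT using that by auto
    ultimately show "supports (M f g) (?R f g)" "\<And>l. supports l (?R f g) \<Longrightarrow> between (N f) (M f g) l"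
      using M0[OF that(1)] by metis+
  qed
  define th where "th = (\<lambda>f. ang n (N f))"
  have face: "\<exists>G\<in>Fam. S \<subseteq> G" if "S \<subset> F" for S
    using deep_proper_subset[OF Suc.prems(1) that] .
  have faceC: "\<exists>G\<in>Fam. S \<subseteq> G" if "f \<in> F" "S \<subset> ?C f" for S f
    using deep_proper_subset[OF *[OF that(1)] that(2)] .
  have cd1: "card (F - {f}) = d - 1" if "f \<in> F" for f using that finF cF by simp
  have cd2: "card (F - {f,g}) = d - 2" if "f \<in> F" "g \<in> F" "f \<noteq> g" for f g
    using that finF cF by (simp add: card_Diff_subset)
  have cR: "i + 3 \<le> card (?R f g)" if "f \<in> F" "g \<in> F" "f \<noteq> g" for f g
  proof -
    have "card (?R f g) = Suc (card (F - {f, g}))" using finF p by (intro card_insert_disjoint) auto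
    then show ?thesis unfolding cd2[OF that] using id by simp
  qed
  have sl: "0 < lor l l" if "f \<in> A" "l \<noteq> 0" "vanishes l (F - {f})" for l f
  proof -
    have "F - {f} \<subset> F" using that A by auto
    then obtain G where G: "G \<in> Fam" "F - {f} \<subseteq> G" using face by blast
    have "T \<subseteq> F - {f}" using that TF by (auto simp: A_def)
    moreover have "finite (F - {f})" using finF by simp
    moreover have "i + 3 \<le> card (F - {f})" using cd1[of f] that A id by auto
    ultimately show ?thesis using spacelike[OF _ G(2,1)] that by blast
  qed
  have slR: "0 < lor l l" if "f \<in> A" "g \<in> A" "f \<noteq> g" "l \<noteq> 0" "vanishes l (?R f g)" for l f g
  proof -
    have fF: "f \<in> F" using that A by blast
    have "?R f g \<subset> ?C f" using that A p by auto
    from faceC[OF fF this] obtain G where G: "G \<in> Fam" "?R f g \<subseteq> G" by blast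
    have "T \<subseteq> ?R f g" using that TF by (auto simp: A_def)
    moreover have "finite (?R f g)" using finF by simp
    moreover have "i + 3 \<le> card (?R f g)" by (rule cR) (use that A in auto)
    ultimately show ?thesis using spacelike[OF _ G(2,1)] that by blast
  qed
  have lN: "0 < lor (N f) (N f)" if "f \<in> A" for f
    by (rule sl[OF that]) (use that A N N0 in \<open>auto simp: vanishes_def\<close>)
  have ln: "0 < lor n n" 
  proof -
    obtain f where "f \<in> A" using A D4 by fastforce
    then show ?thesis by (rule sl) (use n0 vn in \<open>auto simp: vanishes_def\<close>)
  qed
  have vanN: "vanishes (N f) (F - {f})" if "f \<in> F" for f
    using N(1)[OF that] by (auto simp: vanishes_def)
  have pt: "thesis" if f: "f \<in> A" and *: "\<And>y. y \<noteq> 0 \<Longrightarrow> lor y y \<le> 0 \<Longrightarrow> (\<And>l. vanishes l (F - {f}) \<Longrightarrow> l \<bullet> y = 0) \<Longrightarrow> thesis" for f and thesis :: bool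
  proof -
    have "F - {f} \<subset> F" using f A by auto
    then obtain G where G: "G \<in> Fam" "F - {f} \<subseteq> G" using face by blast
    have 1: "T \<subseteq> F - {f}" using f TF by (auto simp: A_def)
    have 2: "finite (F - {f})" using finF by simp
    have 3: "i + 2 \<le> card (F - {f})" using cd1 f A id by auto
    show thesis using psd_point[OF 1 G(2,1) 2 3] * by blast
  qed
  have pt2: "thesis" if f: "f \<in> A" "g \<in> A" "f \<noteq> g" and *: "\<And>y. y \<noteq> 0 \<Longrightarrow> lor y y \<le> 0 \<Longrightarrow> (\<And>l. vanishes l (F - {f,g}) \<Longrightarrow> l \<bullet> y = 0) \<Longrightarrow> thesis" for f g and thesis :: bool
  proof -
    have "F - {f,g} \<subset> F" using f A by auto
    then obtain G where G: "G \<in> Fam" "F - {f,g} \<subseteq> G" using face by blast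
    have 1: "T \<subseteq> F - {f,g}" using f TF by (auto simp: A_def)
    have 2: "finite (F - {f,g})" using finF by simp
    \<comment> \<open>\<open>F - {f,g}\<close> has \<open>d - 2\<close> vertices, and
      \<open>i + 4 \<le> d\<close> is exactly what lets it contain a cutting face through
      \<open>T\<close>.\<close>
    have 3: "i + 2 \<le> card (F - {f,g})"
    proof -
      have "f \<in> F" "g \<in> F" using f A by auto
      from cd2[OF this f(3)] show ?thesis using id by linarith
    qed
    show thesis using psd_point[OF 1 G(2,1) 2 3] * by blast
  qed
  have th0: "0 \<le> th f" if "f \<in> A" for f
  proof (rule pt[OF that])
    fix y assume y: "y \<noteq> 0" "lor y y \<le> 0" "\<And>l. vanishes l (F - {f}) \<Longrightarrow> l \<bullet> y = 0"
    have "vanishes n (F - {f})" using vn by (auto simp: vanishes_def)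
    then show "0 \<le> th f" unfolding th_def
      using ang_le_pi(1)[OF y(1,2) _ _ ln lN[OF that]] y(3) vanN that A by blast
  qed
  have ang0: "0 \<le> ang (N f) (M f p)" if f: "f \<in> A" for f
  proof (rule pt[OF f])
    fix y assume y: "y \<noteq> 0" "lor y y \<le> 0" "\<And>l. vanishes l (F - {f}) \<Longrightarrow> l \<bullet> y = 0"
    have M: "M f p \<noteq> 0" "vanishes (M f p) (F - {f})" using Mp(1)[OF f] by (auto simp: supports_def)
    have v: "vanishes (N f) (F - {f})" using f A vanN by blast
    show ?thesis
      by (rule ang_le_pi(1)[OF y(1,2) y(3)[OF v] y(3)[OF M(2)] lN[OF f] sl[OF f M]])
  qed
  \<comment> \<open>Around the ridge \<open>F - {f}\<close> the order is \<open>n\<close>,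
    \<open>N f\<close>, \<open>M f p\<close>, so the two angles add up.\<close>
  have step: "th f + ang (N f) (M f p) \<le> ang n (M f p)" if f: "f \<in> A" for f
  proof (rule pt[OF f])
    fix y assume y: "y \<noteq> 0" "lor y y \<le> 0" "\<And>l. vanishes l (F - {f}) \<Longrightarrow> l \<bullet> y = 0"
    have s: "supports (M f p) (F - {f})" by (rule Mp(1)[OF f])
    obtain r t where rt: "0 \<le> r" "0 \<le> t" "N f = r *\<^sub>R n + t *\<^sub>R M f p"
      using betw[OF _ s] f A unfolding between_def by blast
    have "vanishes n (F - {f})" using vn by (auto simp: vanishes_def)
    moreover have "vanishes (M f p) (F - {f})" "0 < lor (M f p) (M f p)"
      using s sl[OF f] by (auto simp: supports_def)
    ultimately show ?thesis unfolding th_def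
      by (intro ang_between[OF y(1,2) y(3) y(3) ln lN[OF f] _ rt(3,1,2)])
  qed
  \<comment> \<open>Around \<open>?R f g\<close> the order is \<open>N f\<close>,
    \<open>M f g\<close>, \<open>M g f\<close>, \<open>N g\<close>. The two outer angles fit into
    \<open>ang (N f) (N g)\<close>, which the triangle inequality through \<open>n\<close> bounds by
    \<open>th f + th g\<close>.\<close>
  have tri: "ang (N f) (M f g) + ang (N g) (M g f) \<le> th f + th g" if f: "f \<in> A" "g \<in> A" "f \<noteq> g" for f g
  proof -
    have fg: "f \<in> F" "g \<in> F" using f A by auto
    have Rs: "?R g f = ?R f g" by (simp add: insert_commute)
    have s1: "supports (M f g) (?R f g)" and b1: "\<And>l. supports l (?R f g) \<Longrightarrow> between (N f) (M f g) l"
      using Mg[of f g] f by auto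
    have s2: "supports (M g f) (?R f g)" using Mg(1)[of g f] f unfolding Rs by auto
    have "ang (N f) (N g) \<le> th f + th g"
    proof (rule pt2[OF f])
      fix y assume y: "y \<noteq> 0" "lor y y \<le> 0" "\<And>l. vanishes l (F - {f,g}) \<Longrightarrow> l \<bullet> y = 0"
      have "vanishes n (F - {f,g})" "vanishes (N f) (F - {f,g})" "vanishes (N g) (F - {f,g})"
        using vn vanN fg by (auto simp: vanishes_def)
      then show "ang (N f) (N g) \<le> th f + th g"
        unfolding th_def ang_commute[of n "N f"] using ln lN f y(3)
        by (intro ang_triangle[OF y(1,2)]) auto
    qed
    moreover have "ang (N f) (M f g) + ang (N g) (M g f) \<le> ang (N f) (N g)"
    proof -
      \<comment> \<open>\<open>M g f\<close> supports, so it is nonpositive at \<open>f\<close> and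
        \<open>g\<close>; its values there give its coefficients in \<open>N f\<close> and
        \<open>N g\<close>.\<close>
      have "between (N f) (M g f) (N g)"
      proof -
        define r where "r = (M g f \<bullet> \<phi> f) / (N f \<bullet> \<phi> f)"
        define t where "t = (M g f \<bullet> \<phi> g) / (N g \<bullet> \<phi> g)"
        have "M g f \<bullet> \<phi> f \<le> 0" "M g f \<bullet> \<phi> g \<le> 0" using s2 fg FV by (auto simp: supports_def)
        then have "0 \<le> r" "0 \<le> t" using Nf fg by (simp_all add: r_def t_def divide_nonpos_neg)
        moreover have "M g f = r *\<^sub>R N f + t *\<^sub>R N g"
        proof (rule eq)
          fix v assume v: "v \<in> insert p F"
          consider "v = f" | "v = g" | "v \<in> ?R f g" "v \<noteq> f" "v \<noteq> g" using v f p fg by auto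
          then show "M g f \<bullet> \<phi> v = (r *\<^sub>R N f + t *\<^sub>R N g) \<bullet> \<phi> v"
          proof cases
            case 1
            then have "N g \<bullet> \<phi> v = 0" using N(1)[OF fg(2)] fg f by (auto simp: vanishes_def)
            then show ?thesis using 1 Nf[OF fg(1)] by (simp add: inner_add_left r_def)
          next
            case 2
            then have "N f \<bullet> \<phi> v = 0" using N(1)[OF fg(1)] fg f by (auto simp: vanishes_def)
            then show ?thesis using 2 Nf[OF fg(2)] by (simp add: inner_add_left t_def)
          next
            case 3
            then have "N f \<bullet> \<phi> v = 0" "N g \<bullet> \<phi> v = 0" "M g f \<bullet> \<phi> v = 0"
              using N(1)[OF fg(1)] N(1)[OF fg(2)] s2 by (auto simp: vanishes_def supports_def)
            then show ?thesis by (simp add: inner_add_left)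
          qed
        qed
        ultimately show ?thesis unfolding between_def by blast
      qed
      then obtain r t where rt: "0 \<le> r" "0 \<le> t" "M g f = r *\<^sub>R N f + t *\<^sub>R N g" unfolding between_def by blast
      \<comment> \<open>Seen from \<open>N f\<close>, \<open>M f g\<close> comes before every
        supporting functional, in particular before \<open>M g f\<close>.\<close>
      obtain r' t' where rt': "0 \<le> r'" "0 \<le> t'" "M f g = r' *\<^sub>R N f + t' *\<^sub>R M g f"
        using b1[OF s2] unfolding between_def by blast
      have l1: "0 < lor (M f g) (M f g)" and l2: "0 < lor (M g f) (M g f)"
        using slR[OF f] s1 s2 by (auto simp: supports_def)
      have vR: "vanishes (N f) (?R f g)" "vanishes (N g) (?R f g)" using N(1) fg by (auto simp: vanishes_def)
      have "?R f g \<subset> ?C f" using fg f p by auto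
      from faceC[OF fg(1) this] obtain G where G: "G \<in> Fam" "?R f g \<subseteq> G" by blast
      have T1: "T \<subseteq> ?R f g" using f TF by (auto simp: A_def)
      have c1: "finite (?R f g)" "i + 2 \<le> card (?R f g)" using cR[OF fg f(3)] finF by auto
      obtain y where y: "y \<noteq> 0" "lor y y \<le> 0" "\<And>l. vanishes l (?R f g) \<Longrightarrow> l \<bullet> y = 0"
        using psd_point[OF T1 G(2,1) c1] by blast
      have v12: "vanishes (M f g) (?R f g)" "vanishes (M g f) (?R f g)" using s1 s2 by (auto simp: supports_def)
      have "ang (N f) (M f g) + ang (M f g) (M g f) \<le> ang (N f) (M g f)"
        by (rule ang_between[OF y(1,2) y(3)[OF vR(1)] y(3)[OF v12(2)] lN[OF f(1)] l1 l2 rt'(3,1,2)])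
      moreover have "ang (N f) (M g f) + ang (M g f) (N g) \<le> ang (N f) (N g)"
        by (rule ang_between[OF y(1,2) y(3)[OF vR(1)] y(3)[OF vR(2)] lN[OF f(1)] l2 lN[OF f(2)] rt(3,1,2)])
      moreover have "0 \<le> ang (M f g) (M g f)"
        by (rule ang_le_pi(1)[OF y(1,2) y(3)[OF v12(1)] y(3)[OF v12(2)] l1 l2])
      ultimately show ?thesis by (simp add: ang_commute)
    qed
    ultimately show ?thesis by simp
  qed
  \<comment> \<open>\<open>Th\<close> collects the tilts from \<open>n\<close> to the children,
    \<open>Q\<close> the children's angles at the ridges of \<open>F\<close>, \<open>S\<close> the
    total angle sought, and \<open>B\<close> the children's angles at their common ridges.\<close>
  define Th where "Th = (\<Sum>f\<in>A. th f)"
  define Q where "Q = (\<Sum>f\<in>A. ang (N f) (M f p))"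
  define S where "S = (\<Sum>f\<in>A. ang n (M f p))"
  have S1: "Th + Q \<le> S" unfolding Th_def Q_def S_def sum.distrib[symmetric]
    by (rule sum_mono) (use step in auto)
  define B where "B = (\<Sum>f\<in>A. \<Sum>g\<in>A - {f}. ang (N f) (M f g))"
  \<comment> \<open>Exchanging the two indices leaves an off-diagonal sum unchanged, so
    \<open>2 * B\<close> can be regrouped into the pairs that \<open>tri\<close> bounds.\<close>
  have off: "(\<Sum>f\<in>A. \<Sum>g\<in>A - {f}. h g f) = (\<Sum>f\<in>A. \<Sum>g\<in>A - {f}. h f g)" for h :: "'v \<Rightarrow> 'v \<Rightarrow> real"
  proof -
    have e: "(\<Sum>g\<in>A - {f}. k g) = (\<Sum>g\<in>A. if f = g then 0 else k g)" for f and k :: "'v \<Rightarrow> real"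
      by (rule sum.mono_neutral_cong_left) (use A in auto)
    show ?thesis unfolding e by (subst sum.swap) (intro sum.cong, auto)
  qed
  have "2 * B = (\<Sum>f\<in>A. \<Sum>g\<in>A - {f}. ang (N f) (M f g) + ang (N g) (M g f))"
    using off[of "\<lambda>f g. ang (N f) (M f g)"] by (simp add: B_def sum.distrib)
  also have "\<dots> \<le> (\<Sum>f\<in>A. \<Sum>g\<in>A - {f}. th f + th g)"
    by (intro sum_mono) (use tri in auto)
  also have "\<dots> = 2 * (\<Sum>f\<in>A. \<Sum>g\<in>A - {f}. th f)"
    using off[of "\<lambda>f g. th f"] by (simp only: sum.distrib)
  also have "(\<Sum>f\<in>A. \<Sum>g\<in>A - {f}. th f) = (real D - 1) * Th"
    unfolding Th_def sum_distrib_left by (rule sum.cong) (use A D4 in \<open>auto simp: of_nat_diff\<close>)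
  finally have B1: "B \<le> (real D - 1) * Th" by simp
  have "real D * L = (\<Sum>f\<in>A. L)" using A by simp
  also have "\<dots> \<le> (\<Sum>f\<in>A. ang (N f) (M f p) + (\<Sum>g\<in>A - {f}. ang (N f) (M f g)))"
    by (rule sum_mono) (rule child_sum)
  also have "\<dots> = Q + B" by (simp add: Q_def B_def sum.distrib)
  finally have QL: "real D * L - (real D - 1) * Th \<le> Q" using B1 by simp
  \<comment> \<open>The recursion applies once the children are stacked themselves. For
    \<open>k = 0\<close> their bound \<open>L\<close> is zero, and the avoiding faces supply the
    starting value.\<close>
  have "pi / 2 * (real (d - i) / real (d - i - 1)) ^ (Suc k - 1) \<le> S"
  proof (cases "k = 0")
    case False
    \<comment> \<open>The lower bounds \<open>Th\<close> and
      \<open>real D * L - (real D - 2) * Th\<close> for \<open>S\<close> cross at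
      \<open>Th = real D / (real D - 1) * L\<close>, where both take this value.\<close>
    have "real D / (real D - 1) * L \<le> S"
    proof (rule ccontr)
      assume n: "\<not> ?thesis"
      have "Th \<le> S" 
      proof -
        have "0 \<le> Q" unfolding Q_def
          by (rule sum_nonneg) (rule ang0)
        then show ?thesis using S1 by simp
      qed
      then have T: "Th < real D / (real D - 1) * L" using n by simp
      have D1: "real D - 1 > 0" "real D - 2 > 0" using D4 by auto
      have "S \<ge> real D * L - (real D - 2) * Th" using QL S1 by (simp add: algebra_simps)
      moreover have "(real D - 2) * Th < (real D - 2) * (real D / (real D - 1) * L)"
        using T D1 by (intro mult_strict_left_mono)
      moreover have "real D * L - (real D - 2) * (real D / (real D - 1) * L) = real D / (real D - 1) * L"
        using D1 by (simp add: field_simps)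
      ultimately show False using n by simp
    qed
    have r: "real D - 1 = real (D - 1)" using D4 by (simp add: of_nat_diff)
    obtain k' where k': "k = Suc k'" using False by (cases k) auto
    have e: "real D / (real D - 1) * L = pi / 2 * (real (d - i) / real (d - i - 1)) ^ (Suc k - 1)"
      unfolding L_def D_def[symmetric] r by (simp add: k' mult_ac)
    show ?thesis unfolding e[symmetric] by fact
  next
    case True
    \<comment> \<open>If all pairs had positive product, the functional of the avoiding face
      \<open>insert p T\<close>, a positive combination of the \<open>N f\<close>, would have
      positive square.\<close>
    have "\<exists>f\<in>A. \<exists>g\<in>A. f \<noteq> g \<and> lor (N f) (N g) \<le> 0"
    proof (rule ccontr)
      assume "\<not> ?thesis"
      then have pos: "0 < lor (N f) (N g)" if "f \<in> A" "g \<in> A" for f g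
        using that lN by (cases "f = g") (auto simp: not_le)
      obtain f0 where f0: "f0 \<in> A" using A D4 by fastforce
      have Tp: "insert p T \<subset> ?C f0"
      proof -
        have "insert p T \<subseteq> ?C f0" using f0 TF by (auto simp: A_def)
        moreover have "card (insert p T) < card (?C f0)" using cC[of f0] f0 A T dpT id by auto
        ultimately show ?thesis by auto
      qed
      have f0F: "f0 \<in> F" using f0 A by blast
      from faceC[OF f0F Tp] obtain G where G: "G \<in> Fam" "insert p T \<subseteq> G" by blast
      have "card (insert p T) = i + 1" using T dpT by simp
      then obtain y where y: "lor y y \<le> 0" "\<forall>v\<in>V. y \<bullet> \<phi> v \<le> 0 \<and> (y \<bullet> \<phi> v = 0 \<longleftrightarrow> v \<in> insert p T)"
        using avoid[OF G(2,1)] by blast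
      \<comment> \<open>Among the normals \<open>N g\<close> with \<open>g \<in> A\<close> only
        \<open>N f\<close> is nonzero at \<open>f\<close>, so the coefficient is the quotient of the
        values there.\<close>
      define c where "c = (\<lambda>f. (y \<bullet> \<phi> f) / (N f \<bullet> \<phi> f))"
      have c: "0 < c f" if "f \<in> A" for f
      proof -
        have "f \<in> V" "f \<notin> insert p T" using that A FV p by (auto simp: A_def)
        then have "y \<bullet> \<phi> f < 0" using y by (simp add: less_le)
        then show ?thesis using Nf[of f] that A by (auto simp: c_def divide_neg_neg)
      qed
      have ye: "y = (\<Sum>f\<in>A. c f *\<^sub>R N f)"
      proof (rule eq)
        fix v assume v: "v \<in> insert p F"
        have e: "(\<Sum>f\<in>A. c f *\<^sub>R N f) \<bullet> \<phi> v = (\<Sum>f\<in>A. c f * (N f \<bullet> \<phi> v))"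
          by (simp add: inner_sum_left)
        show "y \<bullet> \<phi> v = (\<Sum>f\<in>A. c f *\<^sub>R N f) \<bullet> \<phi> v"
        proof (cases "v \<in> A")
          case True
          have "(\<Sum>f\<in>A. c f * (N f \<bullet> \<phi> v)) = (\<Sum>f\<in>A. if f = v then c v * (N v \<bullet> \<phi> v) else 0)"
            by (rule sum.cong) (use True A N(1) in \<open>auto simp: vanishes_def\<close>)
          also have "\<dots> = c v * (N v \<bullet> \<phi> v)" using True A by simp
          also have "\<dots> = y \<bullet> \<phi> v" using Nf[of v] True A by (auto simp: c_def)
          finally show ?thesis using e by simp
        next
          case False
          then have "v \<in> insert p T" "v \<in> V" using v p FV by (auto simp: A_def)
          then have "y \<bullet> \<phi> v = 0" using y by blast
          moreover have "(\<Sum>f\<in>A. c f * (N f \<bullet> \<phi> v)) = 0"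
          proof (rule sum.neutral, rule ballI)
            fix f assume "f \<in> A"
            then have "v \<in> ?C f" "f \<in> F" using False v A by auto
            then show "c f * (N f \<bullet> \<phi> v) = 0" using N(1) by (auto simp: vanishes_def)
          qed
          ultimately show ?thesis using e by simp
        qed
      qed
      have "lor y y = (\<Sum>f\<in>A. \<Sum>g\<in>A. c f * (c g * lor (N g) (N f)))"
        by (simp add: ye lor_sum_left lor_sum_right sum_distrib_left)
      also have "\<dots> > 0"
        using A f0 c pos by (intro sum_pos) (auto intro!: mult_pos_pos)
      finally show False using y by simp
    qed
    then obtain f g where fg: "f \<in> A" "g \<in> A" "f \<noteq> g" "lor (N f) (N g) \<le> 0" by blast
    have "pi / 2 \<le> th f + th g"
    proof (rule pt2[OF fg(1-3)])
      fix y assume y: "y \<noteq> 0" "lor y y \<le> 0" "\<And>l. vanishes l (F - {f,g}) \<Longrightarrow> l \<bullet> y = 0"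
      have v: "vanishes n (F - {f,g})" "vanishes (N f) (F - {f,g})" "vanishes (N g) (F - {f,g})"
        using vn vanN[of f] vanN[of g] fg A by (auto simp: vanishes_def)
      then have "ang (N f) (N g) \<le> th f + th g"
        unfolding th_def ang_commute[of n "N f"] using ln lN fg y(3)
        by (intro ang_triangle[OF y(1,2)]) auto
      moreover have "pi / 2 \<le> ang (N f) (N g)"
        using lN fg y(3) v by (intro ang_ge_pi_half[OF y(1,2)]) auto
      ultimately show ?thesis by simp
    qed
    also have "\<dots> = (\<Sum>h\<in>{f,g}. th h)" using fg by simp
    also have "\<dots> \<le> Th" unfolding Th_def using A fg th0 by (intro sum_mono2) auto
    finally have "pi / 2 \<le> Th" .
    moreover have "Th \<le> S"
      unfolding Th_def S_def
    proof (rule sum_mono)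
      fix f assume f: "f \<in> A"
      show "th f \<le> ang n (M f p)" using step[OF f] ang0[OF f] by simp
    qed
    ultimately show ?thesis using True by simp
  qed
  moreover have "\<forall>f\<in>F - T. supports (M f p) (F - {f}) \<and> (\<forall>l. supports l (F - {f}) \<longrightarrow> between n (M f p) l)"
  proof (intro ballI conjI allI impI)
    fix f assume f: "f \<in> F - T"
    then have fA: "f \<in> A" by (simp add: A_def)
    show "supports (M f p) (F - {f})" by (rule Mp(1)[OF fA])
    fix l assume l: "supports l (F - {f})"
    show "between n (M f p) l"
      by (rule between_trans[OF betw[OF _ l] Mp(2)[OF fA l]]) (use f in auto)
  qed
  ultimately show ?case unfolding S_def A_def by (intro exI[of _ "\<lambda>f. M f p"]) simp
qed

text \<open>Each of the \<open>d - i\<close> angles is at most \<open>pi\<close>, so the total is at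
  most \<open>pi / 2 * (2 * (d - i))\<close>; the condition on \<open>k\<close> puts the exponential
  lower bound above this.\<close>

theorem no_deep_tree:
  assumes "deep Fam k F X" "F \<subseteq> V" "X \<subseteq> V" "card F = d" "T \<subseteq> F" "w \<in> V" "w \<notin> F \<union> X"
    and k: "2 * real (d - i) < (real (d - i) / real (d - i - 1)) ^ (k - 1)" "0 < k"
  shows False
proof -
  obtain n where n: "vanishes n F" "negative n (V - (F \<union> X))" using deep_support assms by blast
  obtain m where m: "\<And>f. f \<in> F - T \<Longrightarrow> supports (m f) (F - {f})"
    and le: "pi / 2 * (real (d - i) / real (d - i - 1)) ^ (k - 1) \<le> (\<Sum>f\<in>F - T. ang n (m f))"
    using deep_ang_bound[OF assms(1-7) n] k by auto
  have finF: "finite F" using assms(4) by (rule finite_card)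
  have n0: "n \<noteq> 0" using n(2) assms(6,7) by (auto simp: negative_def)
  have "(\<Sum>f\<in>F - T. ang n (m f)) \<le> (\<Sum>f\<in>F - T. pi)"
  proof (rule sum_mono)
    fix f assume f: "f \<in> F - T"
    then have "F - {f} \<subset> F" by auto
    then obtain G where G: "G \<in> Fam" "F - {f} \<subseteq> G" using deep_proper_subset[OF assms(1)] by blast
    have 1: "T \<subseteq> F - {f}" using f assms(5) by auto
    have 2: "finite (F - {f})" using finF by simp
    have 3: "i + 3 \<le> card (F - {f})" using f finF assms(4) id by simp
    have vs: "vanishes n (F - {f})" "vanishes (m f) (F - {f})" "m f \<noteq> 0" using n(1) m[OF f] by (auto simp: vanishes_def supports_def)
    have s: "0 < lor n n" "0 < lor (m f) (m f)" using spacelike[OF 1 G(2,1) 2 3] vs n0 by auto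
    have 4: "i + 2 \<le> card (F - {f})" using 3 by simp
    obtain y where y: "y \<noteq> 0" "lor y y \<le> 0" "\<And>l. vanishes l (F - {f}) \<Longrightarrow> l \<bullet> y = 0"
      using psd_point[OF 1 G(2,1) 2 4] by blast
    show "ang n (m f) \<le> pi" by (rule ang_le_pi(2)[OF y(1,2) y(3)[OF vs(1)] y(3)[OF vs(2)] s])
  qed
  also have "\<dots> = real (d - i) * pi"
    using T assms(4,5) finF by (simp add: card_Diff_subset)
  also have "\<dots> = pi / 2 * (2 * real (d - i))" by simp
  finally have "pi / 2 * (real (d - i) / real (d - i - 1)) ^ (k - 1) \<le> pi / 2 * (2 * real (d - i))"
    by (rule order_trans[OF le])
  then have "(real (d - i) / real (d - i - 1)) ^ (k - 1) \<le> 2 * real (d - i)"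
    by (rule mult_left_le_imp_le) simp
  then show False using k(1) by simp
qed

end

section \<open>Faces of a polytope after stacking\<close>

text \<open>Constant functionals are allowed, so the empty face and the whole polytope are included,
  in agreement with \<open>face_of\<close>.\<close>

definition face_vertices :: "'a::euclidean_space set \<Rightarrow> 'a set \<Rightarrow> bool" where
  "face_vertices V S \<longleftrightarrow> S \<subseteq> V \<and> (\<exists>a b. \<forall>v\<in>V. a \<bullet> v \<le> b \<and> (a \<bullet> v = b \<longleftrightarrow> v \<in> S))"

lemma convex_hull_le:
  fixes V :: "'a::euclidean_space set"
  assumes "\<And>v. v \<in> V \<Longrightarrow> a \<bullet> v \<le> b" "x \<in> convex hull V"
  shows "a \<bullet> x \<le> b"
proof -
  have "convex hull V \<subseteq> {x. a \<bullet> x \<le> b}"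
    by (rule hull_minimal) (use assms(1) in \<open>auto simp: convex_halfspace_le\<close>)
  then show ?thesis using assms(2) by auto
qed

lemma convex_hull_supporting:
  fixes V :: "'a::euclidean_space set"
  assumes "finite V" "\<And>v. v \<in> V \<Longrightarrow> a \<bullet> v \<le> b"
  shows "convex hull V \<inter> {x. a \<bullet> x = b} = convex hull {v \<in> V. a \<bullet> v = b}" (is "?L = ?R")
proof
  have "?L face_of convex hull V"
    by (rule face_of_Int_supporting_hyperplane_le[OF convex_convex_hull convex_hull_le[OF assms(2)]])
  then obtain S where S: "S \<subseteq> V" "?L = convex hull S"
    by (rule face_of_convex_hull_subset[OF finite_imp_compact[OF assms(1)]])
  then have "S \<subseteq> ?L" by (simp add: hull_subset)
  then have "S \<subseteq> {v \<in> V. a \<bullet> v = b}" using S by auto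
  then show "?L \<subseteq> ?R" unfolding S(2) by (rule hull_mono)
  show "?R \<subseteq> ?L"
    by (rule hull_minimal) (auto simp: hull_inc intro: convex_Int convex_hyperplane)
qed

lemma face_vertices_face:
  assumes "finite V" "face_vertices V S"
  shows "convex hull S face_of convex hull V" "V \<inter> convex hull S = S"
proof -
  obtain a b where ab: "S \<subseteq> V" "\<forall>v\<in>V. a \<bullet> v \<le> b \<and> (a \<bullet> v = b \<longleftrightarrow> v \<in> S)"
    using assms(2) by (auto simp: face_vertices_def)
  have S: "{v \<in> V. a \<bullet> v = b} = S" using ab by auto
  have e: "convex hull V \<inter> {x. a \<bullet> x = b} = convex hull S"
    using convex_hull_supporting[of V a b] assms(1) ab unfolding S by blast
  show "convex hull S face_of convex hull V" unfolding e[symmetric]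
    by (rule face_of_Int_supporting_hyperplane_le[OF convex_convex_hull convex_hull_le]) (use ab in auto)
  show "V \<inter> convex hull S = S" unfolding e[symmetric] using S by (auto simp: hull_inc)
qed

text \<open>Faces of polytopes are exposed, and the exposing functional is the certificate.\<close>

lemma face_vertices_of_face:
  assumes V: "finite V" and F: "F face_of convex hull V"
  shows "face_vertices V (V \<inter> F)" "F = convex hull (V \<inter> F)"
proof -
  have "F exposed_face_of convex hull V"
    using F exposed_face_of_polyhedron polytope_imp_polyhedron polytope_convex_hull[OF V] by blast
  then obtain a b where ab: "convex hull V \<subseteq> {x. a \<bullet> x \<le> b}" "F = convex hull V \<inter> {x. a \<bullet> x = b}"
    by (auto simp: exposed_face_of_def)
  have le: "a \<bullet> v \<le> b" if "v \<in> V" for v using ab(1) hull_inc[OF that, of convex] by auto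
  have e: "V \<inter> F = {v \<in> V. a \<bullet> v = b}" unfolding ab(2) by (auto simp: hull_inc)
  show "face_vertices V (V \<inter> F)" unfolding face_vertices_def e using le by auto
  show "F = convex hull (V \<inter> F)" unfolding e using convex_hull_supporting[OF V le] ab(2) by simp
qed

lemma face_vertices_self [simp]: "face_vertices V V"
  unfolding face_vertices_def by (intro conjI exI[of _ 0]) auto

text \<open>The isomorphism sends a face to the hull of the relabelled points it contains. These
  points can be recovered from the hull, so inclusion is preserved in both directions.\<close>

lemma inclusion_isomorphic_faces:
  assumes V: "finite V" "finite V'" and s: "bij_betw s V V'"
    and iff: "\<And>S. S \<subseteq> V \<Longrightarrow> face_vertices V S \<longleftrightarrow> face_vertices V' (s ` S)"
  shows "inclusion_isomorphic {F. F face_of convex hull V} {F. F face_of convex hull V'}"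
proof -
  define f where "f F = convex hull (s ` (V \<inter> F))" for F
  have inj: "inj_on s V" and im: "s ` V = V'" using s by (auto simp: bij_betw_def)
  have fv: "face_vertices V' (s ` (V \<inter> F))" if "F face_of convex hull V" for F
    using face_vertices_of_face[OF V(1) that] iff by blast
  have ord: "F \<subseteq> G \<longleftrightarrow> f F \<subseteq> f G" if FG: "F face_of convex hull V" "G face_of convex hull V" for F G
  proof -
    have "F \<subseteq> G \<longleftrightarrow> V \<inter> F \<subseteq> V \<inter> G"
    proof
      assume "V \<inter> F \<subseteq> V \<inter> G"
      then have "convex hull (V \<inter> F) \<subseteq> convex hull (V \<inter> G)" by (rule hull_mono)
      then show "F \<subseteq> G" using face_vertices_of_face(2)[OF V(1)] FG by metis
    qed auto
    also have "\<dots> \<longleftrightarrow> s ` (V \<inter> F) \<subseteq> s ` (V \<inter> G)"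
      using inj by (simp add: inj_on_image_subset_iff)
    also have "\<dots> \<longleftrightarrow> f F \<subseteq> f G"
    proof
      assume "f F \<subseteq> f G"
      then have "V' \<inter> f F \<subseteq> V' \<inter> f G" by blast
      then show "s ` (V \<inter> F) \<subseteq> s ` (V \<inter> G)"
        unfolding f_def using face_vertices_face(2)[OF V(2) fv] FG by simp
    qed (simp add: f_def hull_mono)
    finally show ?thesis .
  qed
  have "bij_betw f {F. F face_of convex hull V} {F. F face_of convex hull V'}"
  proof (rule bij_betw_imageI)
    show "inj_on f {F. F face_of convex hull V}"
      by (rule inj_onI) (use ord in \<open>metis mem_Collect_eq subset_antisym subset_refl\<close>)
    show "f ` {F. F face_of convex hull V} = {F. F face_of convex hull V'}"
    proof
      show "f ` {F. F face_of convex hull V} \<subseteq> {F. F face_of convex hull V'}"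
        unfolding f_def using face_vertices_face(1)[OF V(2) fv] by blast
      show "{F. F face_of convex hull V'} \<subseteq> f ` {F. F face_of convex hull V}"
      proof
        fix F' assume "F' \<in> {F. F face_of convex hull V'}"
        then have F': "F' face_of convex hull V'" by simp
        define S where "S = {v \<in> V. s v \<in> F'}"
        have sS: "s ` S = V' \<inter> F'" using im by (auto simp: S_def)
        have "S \<subseteq> V" by (auto simp: S_def)
        then have fS: "face_vertices V S" using iff[of S] face_vertices_of_face(1)[OF V(2) F'] sS by simp
        have "f (convex hull S) = F'"
          unfolding f_def face_vertices_face(2)[OF V(1) fS] sS
          using face_vertices_of_face(2)[OF V(2) F'] by simp
        then show "F' \<in> f ` {F. F face_of convex hull V}"
          using face_vertices_face(1)[OF V(1) fS] by blast
      qed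
    qed
  qed
  then show ?thesis unfolding inclusion_isomorphic_def using ord by blast
qed

section \<open>Points beyond a single facet\<close>

text \<open>An affine function that vanishes on \<open>F\<close> and at one further point
  \<open>w\<close> of \<open>V\<close> vanishes everywhere. The factor \<open>l\<close> is chosen so
  that subtracting \<open>l\<close> times the inequality of \<open>n\<close> gives such a
  function.\<close>

lemma facet_functional_unique:
  fixes n :: "'a::euclidean_space"
  assumes V: "affine hull V = UNIV" and F: "F \<subseteq> V" "aff_dim F = int DIM('a) - 1"
    and n: "\<forall>v\<in>V. n \<bullet> v \<le> \<beta> \<and> (n \<bullet> v = \<beta> \<longleftrightarrow> v \<in> F)"
    and a: "\<forall>v\<in>V. a \<bullet> v \<le> b" "\<forall>v\<in>F. a \<bullet> v = b"
  shows "\<exists>l\<ge>0. a = l *\<^sub>R n \<and> b = l * \<beta>"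
proof -
  have "aff_dim V = int DIM('a)" using V aff_dim_eq_full by blast
  then have "V \<noteq> F" using F by auto
  then obtain w where w: "w \<in> V" "w \<notin> F" using F by auto
  have nw: "n \<bullet> w < \<beta>" using n w by (simp add: less_le)
  have "affine hull F \<subseteq> {x. n \<bullet> x = \<beta>}"
    by (rule hull_minimal) (use n F in \<open>auto simp: affine_hyperplane\<close>)
  then have "w \<notin> affine hull F" using nw by auto
  then have "aff_dim (insert w F) = int DIM('a)" using F by (simp add: aff_dim_insert)
  then have U: "affine hull (insert w F) = UNIV" by (simp add: aff_dim_eq_full)
  define l where "l = (b - a \<bullet> w) / (\<beta> - n \<bullet> w)"
  have l0: "0 \<le> l" using a(1) w nw by (simp add: l_def)
  have lw: "l * (\<beta> - n \<bullet> w) = b - a \<bullet> w" using nw by (simp add: l_def)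
  have "affine hull (insert w F) \<subseteq> {x. (a - l *\<^sub>R n) \<bullet> x = b - l * \<beta>}"
  proof (rule hull_minimal)
    show "insert w F \<subseteq> {x. (a - l *\<^sub>R n) \<bullet> x = b - l * \<beta>}"
      using lw a(2) n F by (auto simp: inner_diff_left algebra_simps)
  qed (rule affine_hyperplane)
  then have all: "(a - l *\<^sub>R n) \<bullet> x = b - l * \<beta>" for x using U by auto
  \<comment> \<open>Evaluation at the origin removes the constant, and evaluation at the difference
    itself the linear part.\<close>
  from all[of 0] have 0: "b - l * \<beta> = 0" by simp
  from all[of "a - l *\<^sub>R n"] have "a - l *\<^sub>R n = 0" unfolding 0 by simp
  with 0 l0 show ?thesis by (intro exI[of _ l]) auto
qed

text \<open>The point \<open>p\<close> lies beyond the facet spanned by \<open>F\<close> and beneath all other facets.\<close>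

locale beyond_facet =
  fixes V F :: "'a::euclidean_space set" and n :: 'a and \<beta> :: real and p :: 'a and H :: "('a \<times> real) set"
  assumes fin: "finite V" and full: "affine hull V = UNIV" and FV: "F \<subseteq> V"
    and aF: "aff_dim F = int DIM('a) - 1"
    and n: "\<forall>v\<in>V. n \<bullet> v \<le> \<beta> \<and> (n \<bullet> v = \<beta> \<longleftrightarrow> v \<in> F)" and np: "\<beta> < n \<bullet> p"
    and beneath: "\<And>Z. face_vertices V Z \<Longrightarrow> \<not> F \<subseteq> Z \<Longrightarrow>
        \<exists>a b. (\<forall>v\<in>V. a \<bullet> v \<le> b \<and> (a \<bullet> v = b \<longleftrightarrow> v \<in> Z)) \<and> a \<bullet> p < b"
    and H: "finite H" "{x. n \<bullet> x \<le> \<beta> \<and> (\<forall>(a, b)\<in>H. a \<bullet> x \<le> b)} \<subseteq> convex hull V"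
      "\<And>a b. (a, b) \<in> H \<Longrightarrow> (\<forall>v\<in>V. a \<bullet> v \<le> b) \<and> a \<bullet> p < b"
begin

lemma p_notin: "p \<notin> V"
  using n np by force

lemma functional_unique:
  assumes "\<forall>v\<in>V. a \<bullet> v \<le> b" "\<forall>v\<in>F. a \<bullet> v = b"
  shows "\<exists>l\<ge>0. a = l *\<^sub>R n \<and> b = l * \<beta>"
  by (rule facet_functional_unique[OF full FV aF n assms])

lemma all_tight:
  assumes "\<forall>v\<in>V. a \<bullet> v = b" shows "a \<bullet> x = b"
proof -
  have "affine hull V \<subseteq> {x. a \<bullet> x = b}"
    by (rule hull_minimal) (use assms in \<open>auto simp: affine_hyperplane\<close>)
  then show ?thesis using full by auto
qed

text \<open>A proper face not through \<open>p\<close> is an old proper face other than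
  \<open>F\<close>, and such a face survives because its functional can be chosen below its bound at
  \<open>p\<close>. A proper face through \<open>p\<close> is a cone over a proper face of
  \<open>F\<close>: tilting a functional by a multiple of \<open>n\<close> creates it. No others
  arise, since the segment to \<open>p\<close> from a vertex off \<open>F\<close> enters the
  interior of the old polytope.\<close>

lemma face_vertices_insert:
  "face_vertices (insert p V) Z \<longleftrightarrow>
     (p \<notin> Z \<and> face_vertices V Z \<and> Z \<noteq> F \<and> Z \<noteq> V) \<or>
     (p \<in> Z \<and> (Z - {p} = V \<or> (Z - {p} \<subset> F \<and> face_vertices V (Z - {p}))))" (is "?L \<longleftrightarrow> ?R")
proof
  assume ?R
  then consider "p \<notin> Z" "face_vertices V Z" "Z \<noteq> F" "Z \<noteq> V" | "p \<in> Z" "Z - {p} = V"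
    | "p \<in> Z" "Z - {p} \<subset> F" "face_vertices V (Z - {p})" by blast
  then show ?L
  proof cases
    case 1
    \<comment> \<open>A functional tight on \<open>F\<close> is a multiple of \<open>n\<close>,
      which would force \<open>Z\<close> to be \<open>F\<close> or \<open>V\<close>.\<close>
    have "\<not> F \<subseteq> Z"
    proof
      assume FZ: "F \<subseteq> Z"
      obtain a b where ab: "\<forall>v\<in>V. a \<bullet> v \<le> b \<and> (a \<bullet> v = b \<longleftrightarrow> v \<in> Z)" and ZV: "Z \<subseteq> V"
        using 1 by (auto simp: face_vertices_def)
      obtain l where l: "0 \<le> l" "a = l *\<^sub>R n" "b = l * \<beta>"
        using functional_unique[of a b] ab FZ FV by blast
      show False
      proof (cases "l = 0")
        case True
        then show False using l ab ZV 1 by auto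
      next
        case False
        then have "Z = F" using l ab ZV FV n by auto
        then show False using 1 by simp
      qed
    qed
    then obtain a b where "\<forall>v\<in>V. a \<bullet> v \<le> b \<and> (a \<bullet> v = b \<longleftrightarrow> v \<in> Z)" "a \<bullet> p < b"
      using beneath 1 by blast
    moreover have "Z \<subseteq> insert p V" using 1 by (auto simp: face_vertices_def)
    ultimately show ?thesis unfolding face_vertices_def using 1(1)
      by (intro conjI exI[of _ a] exI[of _ b]) auto
  next
    case 2
    then have "Z = insert p V" by auto
    then show ?thesis by simp
  next
    case 3
    then obtain a b where ab: "\<forall>v\<in>V. a \<bullet> v \<le> b \<and> (a \<bullet> v = b \<longleftrightarrow> v \<in> Z - {p})" "a \<bullet> p < b"
      using beneath[of "Z - {p}"] by blast
    \<comment> \<open>The tilt is tuned so that \<open>a + e *\<^sub>R n\<close> attains its bound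
      at \<open>p\<close> as well.\<close>
    define e where "e = (b - a \<bullet> p) / (n \<bullet> p - \<beta>)"
    have e: "0 < e" using ab np by (simp add: e_def)
    have ep: "a \<bullet> p + e * (n \<bullet> p) = b + e * \<beta>"
    proof -
      have "e * (n \<bullet> p - \<beta>) = b - a \<bullet> p" using np by (simp add: e_def)
      then show ?thesis by (simp add: algebra_simps)
    qed
    have v: "a \<bullet> v + e * (n \<bullet> v) \<le> b + e * \<beta> \<and> (a \<bullet> v + e * (n \<bullet> v) = b + e * \<beta> \<longleftrightarrow> v \<in> Z)" if vV: "v \<in> V" for v
    proof -
      have 1: "a \<bullet> v \<le> b" "n \<bullet> v \<le> \<beta>" using ab n vV by auto
      then have 2: "e * (n \<bullet> v) \<le> e * \<beta>" using e by simp
      have "a \<bullet> v + e * (n \<bullet> v) = b + e * \<beta> \<longleftrightarrow> a \<bullet> v = b \<and> e * (n \<bullet> v) = e * \<beta>"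
        using 1 2 by linarith
      also have "\<dots> \<longleftrightarrow> v \<in> Z - {p} \<and> v \<in> F" using e ab n vV by auto
      also have "\<dots> \<longleftrightarrow> v \<in> Z" using 3 vV p_notin by auto
      finally show ?thesis using 1 2 by linarith
    qed
    have "Z \<subseteq> insert p V" using 3 FV by auto
    then show ?thesis unfolding face_vertices_def
      using v ep 3(1)
      by (intro conjI exI[of _ "a + e *\<^sub>R n"] exI[of _ "b + e * \<beta>"]) (auto simp: inner_add_left)
  qed
next
  assume ?L
  then obtain a b where Z: "Z \<subseteq> insert p V" and ab: "\<forall>v\<in>insert p V. a \<bullet> v \<le> b \<and> (a \<bullet> v = b \<longleftrightarrow> v \<in> Z)"
    by (auto simp: face_vertices_def)
  show ?R
  proof (cases "p \<in> Z")
    case False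
    then have ap: "a \<bullet> p < b" using ab by (auto simp: less_le)
    have "face_vertices V Z" unfolding face_vertices_def using Z ab False by blast
    moreover have "Z \<noteq> V" using all_tight[of a b p] ab ap by auto
    moreover have "Z \<noteq> F"
    proof
      assume "Z = F"
      then obtain l where l: "0 \<le> l" "a = l *\<^sub>R n" "b = l * \<beta>"
        using functional_unique[of a b] ab FV by blast
      have "l * \<beta> \<le> l * (n \<bullet> p)" using l np by (simp add: mult_left_mono)
      then show False using ap l by simp
    qed
    ultimately show ?thesis using False by blast
  next
    case True
    then have ap: "a \<bullet> p = b" using ab by auto
    define S where "S = Z - {p}"
    have SV: "S \<subseteq> V" using Z by (auto simp: S_def)
    have abS: "\<forall>v\<in>V. a \<bullet> v \<le> b \<and> (a \<bullet> v = b \<longleftrightarrow> v \<in> S)" using ab p_notin by (auto simp: S_def)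
    have fS: "face_vertices V S" unfolding face_vertices_def using SV abS by blast
    show ?thesis
    proof (cases "S = V")
      case True
      then show ?thesis using \<open>p \<in> Z\<close> by (simp add: S_def)
    next
      case SneV: False
      have a0: "a \<noteq> 0"
      proof
        assume "a = 0"
        then have "b = 0" using ap by simp
        then show False using \<open>a = 0\<close> abS SV SneV by auto
      qed
      have SF: "S \<subseteq> F"
      proof (rule ccontr)
        assume "\<not> S \<subseteq> F"
        then obtain v where v: "v \<in> S" "v \<notin> F" by blast
        then have vV: "v \<in> V" using SV by auto
        have nv: "n \<bullet> v < \<beta>" using n vV v by (simp add: less_le)
        \<comment> \<open>\<open>y\<close> is placed on the segment from \<open>v\<close> to
          \<open>p\<close> where \<open>n\<close> is halfway between its value at \<open>v\<close>
          and \<open>\<beta>\<close>, so strictly beneath \<open>F\<close>. The inequalities in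
          \<open>H\<close> are strict there too, so \<open>y\<close> is interior, while
          \<open>a\<close> is maximal at it.\<close>
        define t where "t = (\<beta> - n \<bullet> v) / (2 * (n \<bullet> p - n \<bullet> v))"
        have t: "0 < t" "t < 1" using nv np by (auto simp: t_def field_simps)
        have tn: "t * (n \<bullet> p - n \<bullet> v) = (\<beta> - n \<bullet> v) / 2" using nv np unfolding t_def by (simp add: field_simps)
        define y where "y = (1 - t) *\<^sub>R v + t *\<^sub>R p"
        define U where "U = {x. n \<bullet> x < \<beta>} \<inter> (\<Inter>(a, b)\<in>H. {x. a \<bullet> x < b})"
        have U: "open U" unfolding U_def
          using H(1) by (intro open_Int open_INT) (auto simp: open_halfspace_lt)
        have "n \<bullet> y = n \<bullet> v + t * (n \<bullet> p - n \<bullet> v)" by (simp add: y_def inner_simps algebra_simps)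
        then have "n \<bullet> y = n \<bullet> v + (\<beta> - n \<bullet> v) / 2" using tn by simp
        moreover have "z + (\<beta> - z) / 2 < \<beta>" if "z < \<beta>" for z using that by (simp add: field_simps)
        ultimately have "n \<bullet> y < \<beta>" using nv by metis
        moreover have "a' \<bullet> y < b'" if "(a', b') \<in> H" for a' b'
        proof -
          have "a' \<bullet> v \<le> b'" "a' \<bullet> p < b'" using H(3)[OF that] vV by auto
          then have "(1 - t) * (a' \<bullet> v) + t * (a' \<bullet> p) < (1 - t) * b' + t * b'"
            using t by (intro add_le_less_mono mult_left_mono) auto
          then show ?thesis by (simp add: y_def inner_simps algebra_simps)
        qed
        ultimately have yU: "y \<in> U" unfolding U_def by auto
        have UP: "U \<subseteq> convex hull V"
        proof
          fix z assume "z \<in> U"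
          then have "z \<in> {x. n \<bullet> x \<le> \<beta> \<and> (\<forall>(a, b)\<in>H. a \<bullet> x \<le> b)}" by (fastforce simp: U_def)
          then show "z \<in> convex hull V" using H(2) by blast
        qed
        have av: "a \<bullet> v = b" using abS v vV by auto
        have ay: "a \<bullet> y = b" by (simp add: y_def inner_simps ap av algebra_simps)
        obtain e where e: "0 < e" "cball y e \<subseteq> U" using U yU by (auto simp: open_contains_cball)
        have "y + (e / norm a) *\<^sub>R a \<in> cball y e" using a0 e by (simp add: dist_norm)
        then have "y + (e / norm a) *\<^sub>R a \<in> convex hull V" using e UP by blast
        then have "a \<bullet> (y + (e / norm a) *\<^sub>R a) \<le> b"
          using convex_hull_le abS by blast
        moreover have "0 < (e / norm a) * (a \<bullet> a)" using a0 e by simp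
        ultimately show False using ay by (simp add: inner_simps)
      qed
      moreover have "S \<noteq> F"
      proof
        assume "S = F"
        then obtain l where l: "0 \<le> l" "a = l *\<^sub>R n" "b = l * \<beta>"
          using functional_unique[of a b] abS FV by blast
        then have "l * (n \<bullet> p) = l * \<beta>" using ap by simp
        then have "l = 0" using np by simp
        then show False using a0 l by simp
      qed
      ultimately show ?thesis using True fS by (auto simp: S_def)
    qed
  qed
qed

end

lemma mean_le:
  fixes F :: "'a::euclidean_space set"
  assumes F: "finite F" "F \<noteq> {}" and le: "\<And>v. v \<in> F \<Longrightarrow> a \<bullet> v \<le> b"
  defines "c \<equiv> (1 / real (card F)) *\<^sub>R \<Sum>F"
  shows "a \<bullet> c \<le> b" "a \<bullet> c = b \<Longrightarrow> v \<in> F \<Longrightarrow> a \<bullet> v = b"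
proof -
  have cd: "0 < real (card F)" using F by (simp add: card_gt_0_iff)
  have e: "(b - a \<bullet> c) * real (card F) = (\<Sum>v\<in>F. b - a \<bullet> v)"
    using cd by (simp add: c_def inner_sum_right sum_subtractf algebra_simps)
  have nn: "0 \<le> (\<Sum>v\<in>F. b - a \<bullet> v)" using le by (intro sum_nonneg) auto
  show "a \<bullet> c \<le> b" using e nn cd by (metis diff_ge_0_iff_ge zero_le_mult_iff not_le)
  show "a \<bullet> v = b" if "a \<bullet> c = b" "v \<in> F"
  proof -
    have "(\<Sum>v\<in>F. b - a \<bullet> v) = 0" using e that by simp
    then have "b - a \<bullet> v = 0"
      using sum_nonneg_eq_0_iff[of F "\<lambda>v. b - a \<bullet> v"] F le that by auto
    then show ?thesis by simp
  qed
qed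

text \<open>The mean of \<open>F\<close> satisfies strictly every supporting inequality that is not
  tight on all of \<open>F\<close>, and finitely many strict inequalities persist nearby. Those
  tight on \<open>F\<close> are multiples of the one of \<open>n\<close>, so a nearby point outside
  the hull violates that one. \<open>H\<close> is fixed before \<open>p\<close>, so that all nearby
  points share it.\<close>

lemma eventually_beyond_facet:
  fixes V F :: "'a::euclidean_space set"
  assumes V: "finite V" "affine hull V = UNIV" and F: "F \<subseteq> V" "F \<noteq> {}" "aff_dim F = int DIM('a) - 1"
    and n: "\<forall>v\<in>V. n \<bullet> v \<le> \<beta> \<and> (n \<bullet> v = \<beta> \<longleftrightarrow> v \<in> F)"
  shows "\<exists>H. \<forall>\<^sub>F p in at ((1 / real (card F)) *\<^sub>R \<Sum>F) within (- (convex hull V)). beyond_facet V F n \<beta> p H"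
proof -
  define c where "c = (1 / real (card F)) *\<^sub>R \<Sum>F"
  have finF: "finite F" using V F finite_subset by blast
  obtain HH where HH: "finite HH" "convex hull V = \<Inter>HH"
    "\<forall>h\<in>HH. \<exists>a b. a \<noteq> 0 \<and> h = {x. a \<bullet> x \<le> b}"
    using polytope_imp_polyhedron[OF polytope_convex_hull[OF V(1)]] unfolding polyhedron_def by blast
  obtain A B where AB: "\<And>h. h \<in> HH \<Longrightarrow> A h \<noteq> 0 \<and> h = {x. A h \<bullet> x \<le> B h}" using HH(3) by metis
  have ABV: "A h \<bullet> v \<le> B h" if "h \<in> HH" "v \<in> convex hull V" for h v
    using AB[OF that(1)] HH(2) that by blast
  \<comment> \<open>Of the halfspaces cutting out the hull, those strict at \<open>c\<close> are
    kept; the others follow from the inequality of \<open>n\<close>.\<close>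
  define H where "H = (\<lambda>h. (A h, B h)) ` {h \<in> HH. A h \<bullet> c < B h}"
  have finH: "finite H" using HH(1) by (simp add: H_def)
  have incl: "{x. n \<bullet> x \<le> \<beta> \<and> (\<forall>(a, b)\<in>H. a \<bullet> x \<le> b)} \<subseteq> convex hull V"
  proof
    fix y assume y: "y \<in> {x. n \<bullet> x \<le> \<beta> \<and> (\<forall>(a, b)\<in>H. a \<bullet> x \<le> b)}"
    show "y \<in> convex hull V" unfolding HH(2)
    proof
      fix h assume h: "h \<in> HH"
      have hV: "\<forall>v\<in>V. A h \<bullet> v \<le> B h" using ABV[OF h] by (simp add: hull_inc)
      then have hF: "\<And>v. v \<in> F \<Longrightarrow> A h \<bullet> v \<le> B h" using F by auto
      show "y \<in> h"
      proof (cases "A h \<bullet> c < B h")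
        case True
        then have "A h \<bullet> y \<le> B h" using y h by (auto simp: H_def)
        then show ?thesis using AB[OF h] by blast
      next
        case False
        then have "A h \<bullet> c = B h" using mean_le(1)[OF finF F(2) hF] by (simp add: c_def)
        then have "\<forall>v\<in>F. A h \<bullet> v = B h" using mean_le(2)[OF finF F(2) hF] by (simp add: c_def)
        then obtain l where l: "0 \<le> l" "A h = l *\<^sub>R n" "B h = l * \<beta>"
          using facet_functional_unique[OF V(2) F(1,3) n hV] by blast
        have "A h \<bullet> y \<le> B h" using l y by (simp add: mult_left_mono)
        then show ?thesis using AB[OF h] by blast
      qed
    qed
  qed
  have HV: "\<forall>v\<in>V. a \<bullet> v \<le> b" "a \<bullet> c < b" if "(a, b) \<in> H" for a b
    using that ABV by (auto simp: H_def hull_inc)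
  let ?at = "at c within (- (convex hull V))"
  have cont: "\<forall>\<^sub>F p in ?at. a \<bullet> p < b" if "a \<bullet> c < b" for a b
  proof -
    have "open {x. a \<bullet> x < b}" by (rule open_halfspace_lt)
    then show ?thesis using that unfolding eventually_at_topological by blast
  qed
  define ZZ where "ZZ = {Z. face_vertices V Z \<and> \<not> F \<subseteq> Z}"
  have finZ: "finite ZZ" by (rule finite_subset[of _ "Pow V"]) (use V in \<open>auto simp: ZZ_def face_vertices_def\<close>)
  have "\<forall>Z\<in>ZZ. \<exists>a b. (\<forall>v\<in>V. a \<bullet> v \<le> b \<and> (a \<bullet> v = b \<longleftrightarrow> v \<in> Z))"
    by (auto simp: ZZ_def face_vertices_def)
  then obtain a b where ab: "\<And>Z. Z \<in> ZZ \<Longrightarrow> \<forall>v\<in>V. a Z \<bullet> v \<le> b Z \<and> (a Z \<bullet> v = b Z \<longleftrightarrow> v \<in> Z)"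
    by metis
  have abc: "a Z \<bullet> c < b Z" if Z: "Z \<in> ZZ" for Z
  proof -
    have le: "\<And>v. v \<in> F \<Longrightarrow> a Z \<bullet> v \<le> b Z" using ab[OF Z] F by auto
    obtain f where f: "f \<in> F" "f \<notin> Z" using Z by (auto simp: ZZ_def)
    then have "a Z \<bullet> f \<noteq> b Z" using ab[OF Z] F by auto
    then have "a Z \<bullet> c \<noteq> b Z" using mean_le(2)[OF finF F(2) le] f by (auto simp: c_def)
    then show ?thesis using mean_le(1)[OF finF F(2) le] by (simp add: c_def)
  qed
  have e1: "\<forall>\<^sub>F p in ?at. \<forall>Z\<in>ZZ. a Z \<bullet> p < b Z"
    using finZ abc cont by (simp add: eventually_ball_finite)
  have e2: "\<forall>\<^sub>F p in ?at. \<forall>h\<in>H. fst h \<bullet> p < snd h"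
    by (rule eventually_ball_finite[OF finH]) (use HV cont in auto)
  have e3: "\<forall>\<^sub>F p in ?at. p \<notin> convex hull V" unfolding eventually_at_filter by (rule always_eventually) auto
  have "\<forall>\<^sub>F p in ?at. beyond_facet V F n \<beta> p H"
    using e1 e2 e3
  proof eventually_elim
    case (elim p)
    have "\<not> n \<bullet> p \<le> \<beta>"
    proof
      assume "n \<bullet> p \<le> \<beta>"
      then have "p \<in> {x. n \<bullet> x \<le> \<beta> \<and> (\<forall>(a, b)\<in>H. a \<bullet> x \<le> b)}" using elim(2) by fastforce
      then show False using incl elim(3) by blast
    qed
    moreover have "\<exists>a b. (\<forall>v\<in>V. a \<bullet> v \<le> b \<and> (a \<bullet> v = b \<longleftrightarrow> v \<in> Z)) \<and> a \<bullet> p < b"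
      if "face_vertices V Z" "\<not> F \<subseteq> Z" for Z
      using ab[of Z] elim(1) that unfolding ZZ_def by blast
    moreover have "(\<forall>v\<in>V. a \<bullet> v \<le> b) \<and> a \<bullet> p < b" if "(a, b) \<in> H" for a b
      using HV(1)[OF that] elim(2) that by fastforce
    ultimately show ?case
      using V F n finH incl by unfold_locales auto
  qed
  then show ?thesis unfolding c_def by blast
qed

lemma convex_hull_insert_hull: "convex hull (insert p (convex hull V)) = convex hull (insert p V)"
proof
  have "convex hull V \<subseteq> convex hull (insert p V)" by (rule hull_mono) auto
  then show "convex hull (insert p (convex hull V)) \<subseteq> convex hull (insert p V)"
    by (intro hull_minimal) (auto simp: hull_inc)
  show "convex hull (insert p V) \<subseteq> convex hull (insert p (convex hull V))"
    by (rule hull_mono) (auto simp: hull_inc)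
qed

section \<open>Stacking on explicit vertex sets\<close>

definition stacked_config :: "(real^'d) set \<Rightarrow> bool" where
  "stacked_config V \<longleftrightarrow> finite V \<and> stacked (convex hull V) \<and> affine hull V = UNIV \<and>
     (\<forall>v\<in>V. face_vertices V {v})"

definition simplex_facet :: "(real^'d) set \<Rightarrow> (real^'d) set \<Rightarrow> bool" where
  "simplex_facet V F \<longleftrightarrow> face_vertices V F \<and> \<not> affine_dependent F \<and> card F = CARD('d)"

lemma affine_independent_Int_hull:
  assumes "\<not> affine_dependent F" "S \<subseteq> F"
  shows "F \<inter> convex hull S = S"
proof
  show "F \<inter> convex hull S \<subseteq> S"
  proof
    fix v assume v: "v \<in> F \<inter> convex hull S"
    show "v \<in> S"
    proof (rule ccontr)
      assume "v \<notin> S"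
      then have "S \<subseteq> F - {v}" using assms by auto
      then have "convex hull S \<subseteq> affine hull (F - {v})"
        using convex_hull_subset_affine_hull hull_mono by blast
      then show False using assms(1) v unfolding affine_dependent_def by blast
    qed
  qed
  show "S \<subseteq> F \<inter> convex hull S" using assms by (auto simp: hull_inc)
qed

lemma simplex_facet_subset:
  assumes V: "finite V" and F: "simplex_facet V F" and S: "S \<subseteq> F"
  shows "face_vertices V S"
proof -
  have fF: "face_vertices V F" and ind: "\<not> affine_dependent F" using F by (auto simp: simplex_facet_def)
  have "convex hull S face_of convex hull F"
    using face_of_convex_hull_affine_independent[OF ind] S by blast
  then have "convex hull S face_of convex hull V"
    using face_vertices_face(1)[OF V fF] face_of_trans by blast
  then have "face_vertices V (V \<inter> convex hull S)" by (rule face_vertices_of_face(1)[OF V])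
  moreover have "V \<inter> convex hull S = S"
  proof -
    have "V \<inter> convex hull S \<subseteq> V \<inter> convex hull F" using hull_mono[OF S, of convex] by blast
    then have "V \<inter> convex hull S = F \<inter> convex hull S"
      using face_vertices_face(2)[OF V fF] fF unfolding face_vertices_def by blast
    then show ?thesis using affine_independent_Int_hull[OF ind S] by simp
  qed
  ultimately show ?thesis by simp
qed

lemma simplex_facet_aff_dim:
  fixes F :: "(real^'d) set"
  assumes "simplex_facet V F"
  shows "aff_dim F = int CARD('d) - 1" "F \<noteq> {}" "finite F" "F \<subseteq> V"
proof -
  have "\<not> affine_dependent F" "card F = CARD('d)" using assms by (auto simp: simplex_facet_def)
  then show "aff_dim F = int CARD('d) - 1" using aff_dim_affine_independent by fastforce
  show "F \<noteq> {}" using \<open>card F = CARD('d)\<close> by auto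
  show "finite F" using \<open>\<not> affine_dependent F\<close> by (rule aff_independent_finite)
  show "F \<subseteq> V" using assms by (auto simp: simplex_facet_def face_vertices_def)
qed

text \<open>The description in \<open>face_vertices_insert\<close> is independent of the position of
  \<open>p\<close>, so renaming \<open>p\<close> to \<open>q\<close> is an isomorphism.\<close>

lemma beyond_facet_equivalent:
  assumes "beyond_facet V F n \<beta> p H" "beyond_facet V F n \<beta> q H"
  shows "combinatorially_equivalent (convex hull (insert p V)) (convex hull (insert q V))"
proof -
  interpret p: beyond_facet V F n \<beta> p H by fact
  interpret q: beyond_facet V F n \<beta> q H by fact
  let ?s = "\<lambda>v. if v = p then q else v"
  show ?thesis unfolding combinatorially_equivalent_def
  proof (rule inclusion_isomorphic_faces)
    show "finite (insert p V)" "finite (insert q V)" using p.fin by auto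
    show "bij_betw ?s (insert p V) (insert q V)"
      using p.p_notin q.p_notin by (auto simp: bij_betw_def inj_on_def)
    fix S assume S: "S \<subseteq> insert p V"
    show "face_vertices (insert p V) S \<longleftrightarrow> face_vertices (insert q V) (?s ` S)"
    proof (cases "p \<in> S")
      case True
      have "?s ` S = insert q (S - {p})" using True by auto
      moreover have "insert q (S - {p}) - {q} = S - {p}" using S q.p_notin by auto
      ultimately show ?thesis
        unfolding p.face_vertices_insert q.face_vertices_insert using True by simp
    next
      case False
      then have "?s ` S = S" by auto
      moreover have "q \<notin> S" using False S q.p_notin by auto
      ultimately show ?thesis
        unfolding p.face_vertices_insert q.face_vertices_insert using False by simp
    qed
  qed
qed

text \<open>The definition of \<open>stacked\<close> compares with all points outside the polytope
  near the barycenter. One such point is picked as the new vertex; it is equivalent to the others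
  because they lie beyond the same facet.\<close>

lemma stack_facet:
  fixes V F :: "(real^'d) set"
  assumes V: "stacked_config V" and F: "simplex_facet V F" and d: "2 \<le> CARD('d)"
  shows "\<exists>p. p \<notin> V \<and> stacked_config (insert p V) \<and>
    (\<forall>G. simplex_facet V G \<longrightarrow> G \<noteq> F \<longrightarrow> simplex_facet (insert p V) G) \<and>
    (\<forall>f\<in>F. simplex_facet (insert p V) (insert p (F - {f})))"
proof -
  have finV: "finite V" and full: "affine hull V = UNIV" and st: "stacked (convex hull V)"
    and vx: "\<And>v. v \<in> V \<Longrightarrow> face_vertices V {v}" using V by (auto simp: stacked_config_def)
  note aF = simplex_facet_aff_dim[OF F]
  have ind: "\<not> affine_dependent F" and cF: "card F = CARD('d)" and fF: "face_vertices V F"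
    using F by (auto simp: simplex_facet_def)
  obtain n \<beta> where n: "\<forall>v\<in>V. n \<bullet> v \<le> \<beta> \<and> (n \<bullet> v = \<beta> \<longleftrightarrow> v \<in> F)"
    using fF by (auto simp: face_vertices_def)
  define c where "c = (1 / real (card F)) *\<^sub>R \<Sum>F"
  have aV: "aff_dim V = int CARD('d)" using full aff_dim_eq_full[of V] by simp
  obtain H where H: "\<forall>\<^sub>F p in at c within (- (convex hull V)). beyond_facet V F n \<beta> p H"
    using eventually_beyond_facet[OF finV full aF(4,2) _ n] aF(1) by (auto simp: c_def)
  have nc: "n \<bullet> c = \<beta>"
  proof (rule antisym)
    have "\<And>v. v \<in> F \<Longrightarrow> n \<bullet> v \<le> \<beta>" using n aF(4) by auto
    then show "n \<bullet> c \<le> \<beta>" unfolding c_def by (rule mean_le(1)[OF aF(3,2)])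
    have "\<And>v. v \<in> F \<Longrightarrow> (- n) \<bullet> v \<le> - \<beta>" using n aF(4) by auto
    then have "(- n) \<bullet> c \<le> - \<beta>" unfolding c_def by (rule mean_le(1)[OF aF(3,2)])
    then show "\<beta> \<le> n \<bullet> c" by simp
  qed
  have n0: "n \<noteq> 0"
  proof
    assume "n = 0"
    moreover from this have "\<beta> = 0" using nc by simp
    ultimately have "V \<subseteq> F" using n by auto
    then have "aff_dim V \<le> aff_dim F" by (rule aff_dim_subset)
    then show False using aV aF(1) by simp
  qed
  \<comment> \<open>Moving from \<open>c\<close> along the outward normal leaves the polytope at
    once, so the filter is nontrivial and \<open>p\<close> can be drawn from it.\<close>
  have "c islimpt (- (convex hull V))" unfolding islimpt_approachable
  proof (intro allI impI)
    fix e :: real assume e: "0 < e"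
    define x where "x = c + (e / (2 * norm n)) *\<^sub>R n"
    have "0 < (e / (2 * norm n)) * (n \<bullet> n)" using e n0 by simp
    then have "\<beta> < n \<bullet> x" using nc by (simp add: x_def inner_simps)
    moreover have "\<And>v. v \<in> V \<Longrightarrow> n \<bullet> v \<le> \<beta>" using n by auto
    ultimately have "x \<notin> convex hull V" using convex_hull_le[of V n \<beta> x] by fastforce
    moreover have "x \<noteq> c" "dist x c < e" using e n0 by (auto simp: x_def dist_norm)
    ultimately show "\<exists>x'\<in>- (convex hull V). x' \<noteq> c \<and> dist x' c < e" by blast
  qed
  then have "at c within (- (convex hull V)) \<noteq> bot"
    by (simp add: trivial_limit_within)
  then obtain p where p: "beyond_facet V F n \<beta> p H" using H eventually_happens' by blast
  interpret p: beyond_facet V F n \<beta> p H by fact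
  have bary: "barycenter (convex hull F) = c"
    unfolding barycenter_def c_def using ind
    by (simp add: extreme_point_of_convex_hull_affine_independent)
  have st': "stacked (convex hull (insert p V))"
  proof (rule stacked.stack[OF st, of "convex hull F"])
    show "convex hull F facet_of convex hull V"
      unfolding facet_of_def using face_vertices_face(1)[OF finV fF] aF aV by (simp add: aff_dim_convex_hull)
    show "(int CARD('d) - 1) simplex convex hull F"
      unfolding simplex_def using ind cF by (intro exI[of _ F]) simp
    show "polytope (convex hull (insert p V))" using finV by (intro polytope_convex_hull) simp
    have "aff_dim V \<le> aff_dim (insert p V)" by (rule aff_dim_subset) auto
    moreover have "aff_dim (insert p V) \<le> int DIM(real^'d)" by (rule aff_dim_le_DIM)
    ultimately show "aff_dim (convex hull (insert p V)) = int CARD('d)"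
      using aV by (simp add: aff_dim_convex_hull)
    show "\<forall>\<^sub>F q in at (barycenter (convex hull F)) within (- (convex hull V)).
       combinatorially_equivalent (convex hull (insert p V)) (convex hull (insert q (convex hull V)))"
      unfolding bary convex_hull_insert_hull
      using H by eventually_elim (rule beyond_facet_equivalent[OF p])
  qed
  have notV: "F \<noteq> V" using aV aF(1) by auto
  have cV: "G \<noteq> V" if "card G \<le> CARD('d)" for G
    using aff_dim_le_card[OF finV] aV that by auto
  have "stacked_config (insert p V)" unfolding stacked_config_def
  proof (intro conjI ballI)
    show "finite (insert p V)" using finV by simp
    show "stacked (convex hull (insert p V))" by (rule st')
    show "affine hull insert p V = UNIV" using full hull_mono[of V "insert p V" affine] by auto
    fix v assume v: "v \<in> insert p V"
    show "face_vertices (insert p V) {v}"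
    proof (cases "v = p")
      case True
      have "face_vertices V {}" by (rule simplex_facet_subset[OF finV F]) simp
      then show ?thesis using True aF(2) unfolding p.face_vertices_insert by auto
    next
      case False
      \<comment> \<open>Dimension at least two keeps a single vertex from being the facet that
        disappears.\<close>
      have "{v} \<noteq> F" using cF d by auto
      moreover have "{v} \<noteq> V" using cV[of "{v}"] d by auto
      ultimately show ?thesis using False v vx unfolding p.face_vertices_insert by auto
    qed
  qed
  moreover have "simplex_facet (insert p V) G" if G: "simplex_facet V G" "G \<noteq> F" for G
  proof -
    have "p \<notin> G" using simplex_facet_aff_dim(4)[OF G(1)] p.p_notin by auto
    moreover have "G \<noteq> V" using cV G by (auto simp: simplex_facet_def)
    ultimately show ?thesis using G unfolding simplex_facet_def p.face_vertices_insert by blast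
  qed
  moreover have "simplex_facet (insert p V) (insert p (F - {f}))" if f: "f \<in> F" for f
  proof -
    have pF: "p \<notin> F" using aF p.p_notin by auto
    have e: "insert p (F - {f}) - {p} = F - {f}" using pF by auto
    have "face_vertices V (F - {f})" by (rule simplex_facet_subset[OF finV F]) auto
    then have 1: "face_vertices (insert p V) (insert p (F - {f}))"
      unfolding p.face_vertices_insert e using f by auto
    have "affine hull F \<subseteq> {x. n \<bullet> x = \<beta>}"
      by (rule hull_minimal) (use n aF(4) in \<open>auto simp: affine_hyperplane\<close>)
    then have "p \<notin> affine hull F" using p.np by auto
    then have "p \<notin> affine hull (F - {f})" using hull_mono[of "F - {f}" F affine] by auto
    moreover have "\<not> affine_dependent (F - {f})" using ind affine_dependent_subset by blast
    ultimately have 2: "\<not> affine_dependent (insert p (F - {f}))" by (simp add: affine_independent_insert)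
    show ?thesis unfolding simplex_facet_def
      using 1 2 card_exchange[OF aF(3) f pF] cF by simp
  qed
  ultimately show ?thesis using p.p_notin by blast
qed

text \<open>The children are stacked one after another, so each tree must survive the later ones.
  Only simplex facets inside the current vertex set that equal the root are lost, and the family
  records only the root and facets with a vertex outside \<open>V\<close>. Hence no recorded facet
  of one tree is the root of a sibling.\<close>

lemma deep_stacking:
  fixes V F :: "(real^'d) set"
  assumes d: "2 \<le> CARD('d)" and "stacked_config V" "simplex_facet V F"
  shows "\<exists>V' X. stacked_config V' \<and> V' = V \<union> X \<and> X \<inter> V = {} \<and>
    deep {G. simplex_facet V' G \<and> (G = F \<or> \<not> G \<subseteq> V)} k F X \<and>
    (\<forall>G. simplex_facet V G \<longrightarrow> G \<noteq> F \<longrightarrow> simplex_facet V' G)"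
  using assms(2,3)
proof (induction k arbitrary: V F)
  case 0
  then show ?case by (intro exI[of _ V] exI[of _ "{}"]) auto
next
  case (Suc k)
  obtain p where p: "p \<notin> V" "stacked_config (insert p V)"
    "\<And>G. simplex_facet V G \<Longrightarrow> G \<noteq> F \<Longrightarrow> simplex_facet (insert p V) G"
    "\<And>f. f \<in> F \<Longrightarrow> simplex_facet (insert p V) (insert p (F - {f}))"
    using stack_facet[OF Suc.prems d] by blast
  define V1 where "V1 = insert p V"
  let ?C = "\<lambda>f. insert p (F - {f})"
  have FV: "F \<subseteq> V" and finF: "finite F" using simplex_facet_aff_dim[OF Suc.prems(2)] by auto
  have pF: "p \<notin> F" using FV p(1) by auto
  have Cne: "?C f \<noteq> ?C g" if "f \<in> F" "g \<in> F" "f \<noteq> g" for f g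
  proof
    assume "?C f = ?C g"
    then have "g \<in> ?C g" using that by blast
    then show False using that pF by auto
  qed
  have CV1: "?C f \<subseteq> V1" for f using FV by (auto simp: V1_def)
  \<comment> \<open>Induction over the set \<open>A\<close> of children already processed; the other
    simplex facets, including the children still waiting, are kept.\<close>
  have "\<exists>V' Y. stacked_config V' \<and> V' = V1 \<union> (\<Union>f\<in>A. Y f) \<and> (\<forall>f\<in>A. Y f \<inter> V1 = {} \<and>
      deep {G. simplex_facet V' G \<and> (G = ?C f \<or> \<not> G \<subseteq> V1)} k (?C f) (Y f)) \<and>
      (\<forall>G. simplex_facet V1 G \<longrightarrow> (\<forall>f\<in>A. G \<noteq> ?C f) \<longrightarrow> simplex_facet V' G)" if "A \<subseteq> F" for A
    using finite_subset[OF that finF] that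
  proof (induction A rule: finite_induct)
    case empty
    then show ?case using p(2) by (intro exI[of _ V1] exI[of _ "\<lambda>_. {}"]) (auto simp: V1_def)
  next
    case (insert g A)
    then obtain V' Y where I: "stacked_config V'" "V' = V1 \<union> (\<Union>f\<in>A. Y f)"
      "\<And>f. f \<in> A \<Longrightarrow> Y f \<inter> V1 = {}"
      "\<And>f. f \<in> A \<Longrightarrow> deep {G. simplex_facet V' G \<and> (G = ?C f \<or> \<not> G \<subseteq> V1)} k (?C f) (Y f)"
      "\<And>G. simplex_facet V1 G \<Longrightarrow> (\<forall>f\<in>A. G \<noteq> ?C f) \<Longrightarrow> simplex_facet V' G" by auto
    have g: "g \<in> F" "A \<subseteq> F" using insert.prems by auto
    have gne: "?C g \<noteq> ?C f" if "f \<in> A" for f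
      by (rule Cne) (use that g insert.hyps in auto)
    have "simplex_facet V' (?C g)"
      by (rule I(5)) (use p(4)[OF g(1)] gne in \<open>auto simp: V1_def\<close>)
    from Suc.IH[OF I(1) this] obtain V'' X where J: "stacked_config V''" "V'' = V' \<union> X" "X \<inter> V' = {}"
      "deep {G. simplex_facet V'' G \<and> (G = ?C g \<or> \<not> G \<subseteq> V')} k (?C g) X"
      "\<And>G. simplex_facet V' G \<Longrightarrow> G \<noteq> ?C g \<Longrightarrow> simplex_facet V'' G" by blast
    define Y' where "Y' = Y(g := X)"
    have Y'A: "Y' f = Y f" if "f \<in> A" for f using that insert.hyps by (auto simp: Y'_def)
    have Y'g: "Y' g = X" by (simp add: Y'_def)
    have V1V': "V1 \<subseteq> V'" using I(2) by auto
    have "V'' = V1 \<union> (\<Union>f\<in>insert g A. Y' f)" using J(2) I(2) Y'A Y'g by auto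
    moreover have "Y' f \<inter> V1 = {} \<and> deep {G. simplex_facet V'' G \<and> (G = ?C f \<or> \<not> G \<subseteq> V1)} k (?C f) (Y' f)"
      if f: "f \<in> insert g A" for f
    proof (cases "f = g")
      case True
      have "X \<inter> V1 = {}" using J(3) V1V' by auto
      moreover have "deep {G. simplex_facet V'' G \<and> (G = ?C g \<or> \<not> G \<subseteq> V1)} k (?C g) X"
        by (rule deep_mono[OF J(4)]) (use V1V' in auto)
      ultimately show ?thesis unfolding True Y'g by blast
    next
      case False
      then have fA: "f \<in> A" using f by auto
      have "deep {G. simplex_facet V'' G \<and> (G = ?C f \<or> \<not> G \<subseteq> V1)} k (?C f) (Y f)"
      proof (rule deep_mono[OF I(4)[OF fA]], clarify)
        fix G assume G: "simplex_facet V' G" "G = ?C f \<or> \<not> G \<subseteq> V1"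
        \<comment> \<open>A facet of an earlier tree is a different child or has a vertex outside
          \<open>V1\<close>, whereas \<open>?C g\<close> lies within \<open>V1\<close>.\<close>
        have "G \<noteq> ?C g" using G(2) gne[OF fA] CV1[of g] by metis
        then show "simplex_facet V'' G" using J(5) G(1) by blast
      qed
      then show ?thesis using I(3)[OF fA] Y'A[OF fA] by simp
    qed
    moreover have "simplex_facet V'' G" if "simplex_facet V1 G" "\<forall>f\<in>insert g A. G \<noteq> ?C f" for G
      using J(5)[of G] I(5)[of G] that by auto
    ultimately show ?case using J(1) by blast
  qed
  from this[OF subset_refl] obtain V' Y where I: "stacked_config V'" "V' = V1 \<union> (\<Union>f\<in>F. Y f)"
      "\<And>f. f \<in> F \<Longrightarrow> Y f \<inter> V1 = {}"
      "\<And>f. f \<in> F \<Longrightarrow> deep {G. simplex_facet V' G \<and> (G = ?C f \<or> \<not> G \<subseteq> V1)} k (?C f) (Y f)"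
      "\<And>G. simplex_facet V1 G \<Longrightarrow> (\<forall>f\<in>F. G \<noteq> ?C f) \<Longrightarrow> simplex_facet V' G" by blast
  let ?X = "insert p (\<Union>f\<in>F. Y f)"
  have "V' = V \<union> ?X" using I(2) by (auto simp: V1_def)
  moreover have XV: "?X \<inter> V = {}" using I(3) p(1) unfolding V1_def by blast
  moreover have "deep {G. simplex_facet V' G \<and> (G = F \<or> \<not> G \<subseteq> V)} (Suc k) F ?X"
  proof -
    have "deep {G. simplex_facet V' G \<and> (G = F \<or> \<not> G \<subseteq> V)} k (?C f) (Y f)" if f: "f \<in> F" for f
    proof (rule deep_mono[OF I(4)[OF f]], clarify)
      fix G assume G: "simplex_facet V' G" "G = ?C f \<or> \<not> G \<subseteq> V1" "G \<noteq> F" "G \<subseteq> V"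
      \<comment> \<open>A child contains the new vertex \<open>p\<close>, so every facet recorded
        for it is also recorded for \<open>F\<close>.\<close>
      have "\<not> ?C f \<subseteq> V" using p(1) by auto
      moreover have "V \<subseteq> V1" by (auto simp: V1_def)
      ultimately show False using G by blast
    qed
    moreover have "F \<inter> ?X = {}" using XV FV by auto
    ultimately show ?thesis unfolding deep.simps by blast
  qed
  moreover have "simplex_facet V' G" if G: "simplex_facet V G" "G \<noteq> F" for G
  proof (rule I(5))
    show "simplex_facet V1 G" using p(3)[OF G] by (simp add: V1_def)
    have "G \<subseteq> V" by (rule simplex_facet_aff_dim(4)[OF G(1)])
    then show "\<forall>f\<in>F. G \<noteq> ?C f" using p(1) by blast
  qed
  ultimately show ?case using I(1) by blast
qed

text \<open>The tree is grown over one facet of a simplex; the opposite vertex \<open>w\<close>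
  stays outside \<open>F \<union> X\<close>.\<close>

lemma stacked_deep_exists:
  assumes d: "2 \<le> CARD('d)"
  shows "\<exists>(V :: (real^'d) set) F X w. stacked_config V \<and> deep {G. simplex_facet V G} k F X \<and>
    F \<subseteq> V \<and> X \<subseteq> V \<and> card F = CARD('d) \<and> w \<in> V \<and> w \<notin> F \<union> X"
proof -
  obtain B :: "(real^'d) set" where B: "\<not> affine_dependent B" "affine hull B = affine hull UNIV"
    using affine_basis_exists by blast
  have full: "affine hull B = UNIV" using B(2) by simp
  have finB: "finite B" using B(1) by (rule aff_independent_finite)
  have "aff_dim B = int CARD('d)" using full aff_dim_eq_full[of B] by simp
  then have cB: "card B = CARD('d) + 1" using aff_dim_affine_independent[OF B(1)] by simp
  then obtain w where w: "w \<in> B" by fastforce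
  have fv: "face_vertices B S" if "S \<subseteq> B" for S
  proof -
    have "convex hull S face_of convex hull B"
      using face_of_convex_hull_affine_independent[OF B(1)] that by blast
    then have "face_vertices B (B \<inter> convex hull S)" by (rule face_vertices_of_face(1)[OF finB])
    then show ?thesis using affine_independent_Int_hull[OF B(1) that] by simp
  qed
  have "int CARD('d) simplex convex hull B"
    unfolding simplex_def using B(1) cB by (intro exI[of _ B]) simp
  then have sc: "stacked_config B" unfolding stacked_config_def
    using finB full fv by (auto intro: stacked.simplex)
  have cBw: "card (B - {w}) = CARD('d)" using cB w finB by simp
  have "\<not> affine_dependent (B - {w})" using affine_dependent_subset[of "B - {w}" B] B(1) by blast
  then have "simplex_facet B (B - {w})" unfolding simplex_facet_def
    using fv[of "B - {w}"] cBw by simp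
  from deep_stacking[OF d sc this, of k] obtain V X where V: "stacked_config V" "V = B \<union> X" "X \<inter> B = {}"
    "deep {G. simplex_facet V G \<and> (G = B - {w} \<or> \<not> G \<subseteq> B)} k (B - {w}) X"
    by (elim exE conjE) (rule that)
  have "deep {G. simplex_facet V G} k (B - {w}) X" by (rule deep_mono[OF V(4)]) auto
  moreover have "w \<notin> B - {w} \<union> X" using V(3) w by auto
  moreover have "B - {w} \<subseteq> V" "X \<subseteq> V" "w \<in> V" using V(2) w by auto
  ultimately show ?thesis using V(1) cBw
    by (intro exI[of _ V] exI[of _ "B - {w}"] exI[of _ X] exI[of _ w] conjI)
qed

section \<open>Spherical realizations\<close>

lemma cap_lor:
  fixes x :: "real \<times> (real^'d)"
  shows "x \<in> cap \<longleftrightarrow> norm x = 1 \<and> 0 \<le> fst x \<and> lor x x \<le> 0"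
  by (simp add: cap_def lor_def inner_vec_def power2_eq_square)

lemma lor_nonpos_of_cap:
  fixes a :: "real \<times> (real^'d)"
  assumes "cap \<subseteq> hemisphere a"
  shows "lor a a \<le> 0"
proof -
  \<comment> \<open>The test point is the lightlike unit vector pointing along \<open>snd a\<close>,
    or the pole when \<open>snd a = 0\<close>; there the hemisphere condition amounts to
    \<open>fst a + norm (snd a) \<le> 0\<close>.\<close>
  define y where "y = (if snd a = 0 then (1, 0) else (1 / sqrt 2, (1 / (sqrt 2 * norm (snd a))) *\<^sub>R snd a))"
  have "y \<in> cap"
    unfolding cap_lor lor_def
    by (auto simp: y_def norm_Pair power_divide power2_norm_eq_inner[symmetric] power_mult_distrib
        power2_eq_square[symmetric] real_sqrt_divide)
  then have "a \<bullet> y \<le> 0" using assms by (auto simp: hemisphere_def)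
  then have "norm (snd a) \<le> - fst a"
  proof (cases "snd a = 0")
    case False
    have "a \<bullet> y = (fst a + norm (snd a)) / sqrt 2"
      using False by (simp add: y_def inner_prod_def dot_square_norm power2_eq_square add_divide_distrib)
    then show ?thesis using \<open>a \<bullet> y \<le> 0\<close> by (simp add: divide_le_0_iff)
  qed (simp add: y_def inner_prod_def)
  then have "(norm (snd a))\<^sup>2 \<le> (- fst a)\<^sup>2" by (rule power_mono) simp
  then show ?thesis by (simp add: lor_def dot_square_norm power2_eq_square)
qed

lemma cone_overI:
  assumes "x \<noteq> 0 \<Longrightarrow> (1 / norm x) *\<^sub>R x \<in> P"
  shows "x \<in> cone_over P"
proof (cases "x = 0")
  case False
  have "\<exists>c y. x = c *\<^sub>R y \<and> 0 \<le> c \<and> y \<in> P"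
    by (intro exI[of _ "norm x"] exI[of _ "(1 / norm x) *\<^sub>R x"]) (use assms False in simp)
  then show ?thesis unfolding cone_over_def conic_hull_explicit by blast
qed (simp add: cone_over_def)

lemma cone_over_hemispheres:
  fixes A :: "'a::euclidean_space set"
  assumes Q: "Q = sphere 0 1 \<inter> (\<Inter>a\<in>A. hemisphere a)"
  shows "cone_over Q = {x. \<forall>a\<in>A. a \<bullet> x \<le> 0}"
proof
  show "cone_over Q \<subseteq> {x. \<forall>a\<in>A. a \<bullet> x \<le> 0}"
    by (auto simp: cone_over_def conic_hull_explicit Q hemisphere_def mult_nonneg_nonpos)
  show "{x. \<forall>a\<in>A. a \<bullet> x \<le> 0} \<subseteq> cone_over Q"
  proof
    fix x assume x: "x \<in> {x. \<forall>a\<in>A. a \<bullet> x \<le> 0}"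
    show "x \<in> cone_over Q"
      by (rule cone_overI) (use x in \<open>auto simp: Q hemisphere_def divide_nonpos_nonneg\<close>)
  qed
qed

section \<open>Transport of the face lattice to a spherical realization\<close>

locale spherical_lattice =
  fixes V :: "(real^'d) set" and Q :: "(real \<times> (real^'d)) set" and f and A
  assumes finV: "finite V" and full: "affine hull V = UNIV"
    and vx: "\<And>v. v \<in> V \<Longrightarrow> face_vertices V {v}"
    and finA: "finite A" and A0: "0 \<notin> A" and Q: "Q = sphere 0 1 \<inter> (\<Inter>a\<in>A. hemisphere a)"
    and dimQ: "spherical_dim Q = int CARD('d)"
    and bij: "bij_betw f {F. F face_of convex hull V} (spherical_faces Q)"
    and order: "\<And>F G. F face_of convex hull V \<Longrightarrow> G face_of convex hull V \<Longrightarrow> F \<subseteq> G \<longleftrightarrow> f F \<subseteq> f G"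
begin

abbreviation "C \<equiv> cone_over Q"

lemma C_eq: "C = {x. \<forall>a\<in>A. a \<bullet> x \<le> 0}"
  by (rule cone_over_hemispheres[OF Q])

lemma C_polyhedron: "polyhedron C"
  unfolding polyhedron_def C_eq
proof (intro exI[of _ "(\<lambda>a. {x. a \<bullet> x \<le> 0}) ` A"] conjI ballI)
  fix h assume "h \<in> (\<lambda>a. {x. a \<bullet> x \<le> 0}) ` A"
  then obtain a where a: "a \<in> A" "h = {x. a \<bullet> x \<le> 0}" by (rule imageE) simp
  then have "a \<noteq> 0" using A0 by metis
  with a(2) show "\<exists>a b. a \<noteq> 0 \<and> h = {x. a \<bullet> x \<le> b}" by (intro exI[of _ a] exI[of _ 0] conjI)
qed (use finA in auto)

lemma C_sphere: "C \<inter> sphere 0 1 = Q"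
proof -
  have "C \<inter> sphere 0 1 = {x. \<forall>a\<in>A. a \<bullet> x \<le> 0} \<inter> sphere 0 1" by (simp only: C_eq)
  also have "\<dots> = Q" unfolding Q by (auto simp: hemisphere_def)
  finally show ?thesis .
qed

lemma C_scale: "x \<in> C \<Longrightarrow> 0 \<le> c \<Longrightarrow> c *\<^sub>R x \<in> C"
  unfolding C_eq by (auto simp: mult_nonneg_nonpos)

lemma C_zero: "0 \<in> C"
  by (simp add: cone_over_def)

lemma face_functional:
  assumes "G face_of C" "G \<noteq> {}"
  obtains a where "\<And>x. x \<in> C \<Longrightarrow> a \<bullet> x \<le> 0" "G = C \<inter> {x. a \<bullet> x = 0}"
proof -
  have "G exposed_face_of C" using exposed_face_of_polyhedron[OF C_polyhedron] assms by simp
  then obtain a b where ab: "C \<subseteq> {x. a \<bullet> x \<le> b}" "G = C \<inter> {x. a \<bullet> x = b}"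
    by (auto simp: exposed_face_of_def)
  obtain x where x: "x \<in> C" "a \<bullet> x = b" using assms(2) ab(2) by blast
  \<comment> \<open>Testing the bound at \<open>0\<close> and at twice a point of the face forces
    \<open>b = 0\<close>.\<close>
  have "a \<bullet> 0 \<le> b" using ab(1) C_zero by blast
  moreover have "a \<bullet> (2 *\<^sub>R x) \<le> b" using ab(1) C_scale[OF x(1), of 2] by auto
  ultimately have "b = 0" using x(2) by simp
  then show ?thesis using that[of a] ab by auto
qed

text \<open>A nonempty face of the cone contains the origin and is closed under scaling, so its
  spherical part determines it.\<close>

lemma cone_over_face:
  assumes "G face_of C" "G \<noteq> {}"
  shows "cone_over (G \<inter> sphere 0 1) = G"
proof -
  obtain a where a: "\<And>x. x \<in> C \<Longrightarrow> a \<bullet> x \<le> 0" "G = C \<inter> {x. a \<bullet> x = 0}"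
    using face_functional[OF assms] by metis
  have sc: "c *\<^sub>R x \<in> G" if "x \<in> G" "0 \<le> c" for c x using that a C_scale by auto
  have z: "0 \<in> G" using a C_zero by auto
  show ?thesis
  proof
    show "cone_over (G \<inter> sphere 0 1) \<subseteq> G"
      using sc z by (auto simp: cone_over_def conic_hull_explicit)
    show "G \<subseteq> cone_over (G \<inter> sphere 0 1)"
    proof
      fix x assume x: "x \<in> G"
      show "x \<in> cone_over (G \<inter> sphere 0 1)"
        by (rule cone_overI) (use sc[OF x, of "1 / norm x"] in simp)
    qed
  qed
qed

definition face_cone :: "(real^'d) set \<Rightarrow> (real \<times> (real^'d)) set" where
  "face_cone S = cone_over (f (convex hull S))"

lemma f_surj:
  assumes "X \<in> spherical_faces Q"
  obtains F where "F face_of convex hull V" "f F = X"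
proof -
  have "X \<in> f ` {F. F face_of convex hull V}" using assms bij by (simp only: bij_betw_imp_surj_on)
  then show ?thesis using that by blast
qed

lemma f_empty: "f {} = {}"
proof -
  have "{} \<in> spherical_faces Q" unfolding spherical_faces_def by (auto intro!: exI[of _ "{}"])
  then obtain F where F: "F face_of convex hull V" "f F = {}"
    by (rule f_surj)
  have "f {} \<subseteq> f F" using order[OF empty_face_of F(1)] by simp
  then show ?thesis using F(2) by simp
qed

lemma f_inj:
  assumes "F face_of convex hull V" "G face_of convex hull V" "f F = f G"
  shows "F = G"
proof (rule subset_antisym)
  show "F \<subseteq> G" using order[OF assms(1,2)] assms(3) by simp
  show "G \<subseteq> F" using order[OF assms(2,1)] assms(3) by simp
qed

lemma f_face:
  assumes "F face_of convex hull V"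
  obtains G where "G face_of C" "f F = G \<inter> sphere 0 1"
proof -
  have "f F \<in> spherical_faces Q" using bij assms unfolding bij_betw_def by blast
  then show ?thesis using that unfolding spherical_faces_def by blast
qed

lemma face_cone:
  assumes S: "face_vertices V S" "S \<noteq> {}"
  shows "face_cone S face_of C" "face_cone S \<noteq> {}" "f (convex hull S) = face_cone S \<inter> sphere 0 1" "f (convex hull S) \<noteq> {}"
proof -
  note Sf = face_vertices_face(1)[OF finV S(1)]
  obtain G where G: "G face_of C" "f (convex hull S) = G \<inter> sphere 0 1" using f_face[OF Sf] by blast
  show ne: "f (convex hull S) \<noteq> {}"
  proof
    assume "f (convex hull S) = {}"
    then have "convex hull S = {}" using f_inj[OF Sf, of "{}"] f_empty by auto
    then show False using S(2) by simp
  qed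
  then have "face_cone S = G" unfolding face_cone_def G(2) using G by (intro cone_over_face) auto
  then show "face_cone S face_of C" "face_cone S \<noteq> {}" "f (convex hull S) = face_cone S \<inter> sphere 0 1" using G ne by auto
qed

text \<open>No dimension is known yet for the spherical face that corresponds to a vertex, so some
  point of it is chosen.\<close>

definition phi :: "real^'d \<Rightarrow> real \<times> (real^'d)" where
  "phi v = (SOME y. y \<in> f {v})"

lemma phi_mem: "v \<in> V \<Longrightarrow> phi v \<in> f {v}"
  using face_cone(4)[OF vx] unfolding phi_def by (simp add: some_in_eq)

text \<open>Spherical faces are closed under intersection. If \<open>v\<close> is not in
  \<open>S\<close>, the common face of \<open>f {v}\<close> and the image of \<open>S\<close> comes
  from a face inside both \<open>{v}\<close> and the hull of \<open>S\<close>, so it is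
  empty.\<close>

lemma phi_iff:
  assumes S: "face_vertices V S" and v: "v \<in> V"
  shows "phi v \<in> f (convex hull S) \<longleftrightarrow> v \<in> S"
proof
  note Sf = face_vertices_face(1)[OF finV S] and vf = face_vertices_face(1)[OF finV vx[OF v]]
  show "phi v \<in> f (convex hull S)" if "v \<in> S"
  proof -
    have "convex hull {v} \<subseteq> convex hull S" using that by (auto simp: hull_inc)
    then have "f (convex hull {v}) \<subseteq> f (convex hull S)" using order[OF vf Sf] by simp
    then show ?thesis using phi_mem[OF v] by auto
  qed
  show "v \<in> S" if *: "phi v \<in> f (convex hull S)"
  proof (rule ccontr)
    assume "v \<notin> S"
    then have nv: "v \<notin> convex hull S" using face_vertices_face(2)[OF finV S] v by auto
    obtain G1 where G1: "G1 face_of C" "f (convex hull {v}) = G1 \<inter> sphere 0 1" using f_face[OF vf] by blast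
    obtain G2 where G2: "G2 face_of C" "f (convex hull S) = G2 \<inter> sphere 0 1" using f_face[OF Sf] by blast
    have "G1 \<inter> G2 face_of C" using G1 G2 by (simp add: face_of_Int)
    then have "f {v} \<inter> f (convex hull S) \<in> spherical_faces Q"
      using G1 G2 unfolding spherical_faces_def by (auto intro!: exI[of _ "G1 \<inter> G2"])
    then obtain X where X: "X face_of convex hull V" "f X = f {v} \<inter> f (convex hull S)"
      by (rule f_surj)
    have "X \<subseteq> {v}" using order[OF X(1) vf] X(2) by auto
    moreover have "X \<subseteq> convex hull S" using order[OF X(1) Sf] X(2) by auto
    ultimately have "X = {}" using nv by auto
    then have "f {v} \<inter> f (convex hull S) = {}" using X(2) f_empty by simp
    then show False using * phi_mem[OF v] by auto
  qed
qed

lemma phi_Q: "v \<in> V \<Longrightarrow> phi v \<in> Q"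
  using phi_mem[of v] face_cone(1,3)[OF vx[of v]] face_of_imp_subset C_sphere by fastforce

lemma phi_C: "v \<in> V \<Longrightarrow> phi v \<in> C"
  using phi_Q C_sphere by blast

lemma phi_nz: "v \<in> V \<Longrightarrow> phi v \<noteq> 0"
  using phi_Q[of v] unfolding Q by auto

lemma phi_cf: "face_vertices V S \<Longrightarrow> S \<noteq> {} \<Longrightarrow> v \<in> V \<Longrightarrow> phi v \<in> face_cone S \<longleftrightarrow> v \<in> S"
  using phi_iff[of S v] face_cone(3)[of S] phi_Q[of v] unfolding Q by blast

lemma support:
  assumes "face_vertices V S" "S \<noteq> {}"
  shows "\<exists>a. \<forall>v\<in>V. a \<bullet> phi v \<le> 0 \<and> (a \<bullet> phi v = 0 \<longleftrightarrow> v \<in> S)"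
proof -
  obtain a where a: "\<And>x. x \<in> C \<Longrightarrow> a \<bullet> x \<le> 0" "face_cone S = C \<inter> {x. a \<bullet> x = 0}"
    using face_functional[OF face_cone(1,2)[OF assms]] by metis
  have "a \<bullet> phi v = 0 \<longleftrightarrow> v \<in> S" if "v \<in> V" for v
    using phi_cf[OF assms that] a(2) phi_C[OF that] by blast
  then show ?thesis using a(1) phi_C by blast
qed

lemma face_cone_mono:
  assumes "face_vertices V S" "S \<noteq> {}" "face_vertices V S'" "S \<subseteq> S'"
  shows "face_cone S face_of face_cone S'"
proof -
  have ne: "S' \<noteq> {}" using assms by auto
  have "f (convex hull S) \<subseteq> f (convex hull S')"
    using order[OF face_vertices_face(1)[OF finV assms(1)] face_vertices_face(1)[OF finV assms(3)]]
      hull_mono[OF assms(4), of convex] by simp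
  then have "face_cone S \<subseteq> face_cone S'" unfolding face_cone_def cone_over_def conic_hull_explicit by blast
  then show ?thesis
    using face_of_subset[OF face_cone(1)[OF assms(1,2)]] face_of_imp_subset[OF face_cone(1)[OF assms(3) ne]] by blast
qed

lemma face_cone_inj:
  assumes "face_vertices V S" "S \<noteq> {}" "face_vertices V S'" "S' \<noteq> {}" "face_cone S = face_cone S'"
  shows "S = S'"
proof -
  have "S \<subseteq> V" "S' \<subseteq> V" using assms by (auto simp: face_vertices_def)
  then show ?thesis using phi_cf[OF assms(1,2)] phi_cf[OF assms(3,4)] assms(5) by blast
qed

lemma face_cone_convex: "face_vertices V S \<Longrightarrow> S \<noteq> {} \<Longrightarrow> convex (face_cone S)"
  using face_cone(1) face_of_imp_convex C_polyhedron polyhedron_imp_convex by blast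

lemma face_cone_aff_dim_less:
  assumes "face_vertices V S" "S \<noteq> {}" "face_vertices V S'" "S \<subset> S'"
  shows "aff_dim (face_cone S) < aff_dim (face_cone S')"
proof (rule face_of_aff_dim_lt)
  have ne: "S' \<noteq> {}" using assms by auto
  show "convex (face_cone S')" by (rule face_cone_convex[OF assms(3) ne])
  show "face_cone S face_of face_cone S'" using face_cone_mono assms by blast
  show "face_cone S \<noteq> face_cone S'" using face_cone_inj[OF assms(1-3) ne] assms(4) by blast
qed

lemma face_cone_zero: "face_vertices V S \<Longrightarrow> S \<noteq> {} \<Longrightarrow> 0 \<in> face_cone S"
  unfolding face_cone_def cone_over_def by simp

text \<open>The isomorphism is only known to respect inclusion. Along a chain of faces dimensions
  increase strictly, from at least one at a vertex to less than \<open>d + 1\<close>, the dimension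
  of the full cone, at \<open>F\<close>. This leaves no room for gaps, so each vertex raises the
  dimension by exactly one.\<close>

lemma face_cone_aff_dim:
  assumes F: "simplex_facet V F" and S: "S \<subseteq> F" "S \<noteq> {}"
  shows "aff_dim (face_cone S) = int (card S)"
proof -
  note fv = simplex_facet_subset[OF finV F]
  note F' = simplex_facet_aff_dim[OF F]
  have cF: "card F = CARD('d)" using F by (simp add: simplex_facet_def)
  have lower: "int (card S) \<le> aff_dim (face_cone S)" if "finite S" "S \<subseteq> F" "S \<noteq> {}" for S
    using that
  proof (induction S rule: finite_induct)
    case (insert v S)
    show ?case
    proof (cases "S = {}")
      case True
      have v: "v \<in> V" using insert.prems F' by auto
      have "{0, phi v} \<subseteq> face_cone {v}" using phi_cf[OF vx[OF v] _ v] face_cone_zero[OF vx[OF v]] by simp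
      then have "aff_dim {0, phi v} \<le> aff_dim (face_cone {v})" by (rule aff_dim_subset)
      then show ?thesis using True phi_nz[OF v] by (simp add: aff_dim_2)
    next
      case False
      have "aff_dim (face_cone S) < aff_dim (face_cone (insert v S))"
        by (rule face_cone_aff_dim_less[OF fv False fv]) (use insert in auto)
      then show ?thesis using insert False by auto
    qed
  qed simp
  have aC: "aff_dim C = int CARD('d) + 1" using dimQ by (simp add: spherical_dim_def)
  \<comment> \<open>Induction on the number of vertices missing from \<open>F\<close>, descending
    from the facet.\<close>
  have upper: "aff_dim (face_cone S) \<le> int (card S)" if "S \<subseteq> F" "S \<noteq> {}" "card F - card S = m" for S m
    using that
  proof (induction m arbitrary: S)
    case 0
    then have SF: "S = F" using F'(3) card_subset_eq[of F S] card_mono[of F S] by auto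
    have fF: "face_vertices V F" by (rule fv) simp
    have "aff_dim V = int CARD('d)" using full aff_dim_eq_full[of V] by simp
    then have "F \<noteq> V" using F'(1) by auto
    then obtain w where w: "w \<in> V" "w \<notin> F" using F'(4) by auto
    have "phi w \<notin> face_cone F" using phi_cf[OF fF F'(2) w(1)] w(2) by simp
    then have "face_cone F \<noteq> C" using phi_C[OF w(1)] by auto
    then have "aff_dim (face_cone F) < aff_dim C"
      using face_of_aff_dim_lt[OF _ face_cone(1)[OF fF F'(2)]] C_polyhedron polyhedron_imp_convex by blast
    then show ?case using SF aC cF by simp
  next
    case (Suc m)
    then obtain v where v: "v \<in> F" "v \<notin> S" by (metis diff_self_eq_0 nat.simps(3) subsetI subset_antisym)
    have finS: "finite S" using Suc.prems F'(3) finite_subset by blast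
    have c: "card (insert v S) = Suc (card S)" using v finS by simp
    have "aff_dim (face_cone S) < aff_dim (face_cone (insert v S))"
      by (rule face_cone_aff_dim_less[OF fv _ fv]) (use Suc.prems v in auto)
    moreover have "aff_dim (face_cone (insert v S)) \<le> int (card (insert v S))"
      by (rule Suc.IH) (use Suc.prems v c in auto)
    ultimately show ?case using c by simp
  qed
  show ?thesis using lower[OF _ S] upper[OF S refl] finite_subset[OF S(1) F'(3)] by simp
qed

text \<open>Functionals supporting \<open>S - {v}\<close>, nonempty as \<open>S\<close> has two
  elements, isolate coefficients, so the vectors \<open>phi v\<close> are independent. They are as
  many as the dimension of the face cone.\<close>

lemma face_cone_span:
  assumes F: "simplex_facet V F" and S: "S \<subseteq> F" "2 \<le> card S"
  shows "face_cone S \<subseteq> span (phi ` S)"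
proof -
  note fv = simplex_facet_subset[OF finV F]
  note F' = simplex_facet_aff_dim[OF F]
  have finS: "finite S" using S F'(3) finite_subset by blast
  have Sne: "S \<noteq> {}" using S(2) by auto
  have SV: "S \<subseteq> V" using S F' by auto
  have z: "u v = 0" if "(\<Sum>v\<in>S. u v *\<^sub>R phi v) = 0" "v \<in> S" for u v
  proof -
    have "card (S - {v}) \<noteq> 0" using that finS S(2) by simp
    then have ne: "S - {v} \<noteq> {}" using card.empty by metis
    have "S - {v} \<subseteq> F" using S by auto
    from support[OF fv[OF this] ne] obtain a where
      a: "\<forall>w\<in>V. a \<bullet> phi w \<le> 0 \<and> (a \<bullet> phi w = 0 \<longleftrightarrow> w \<in> S - {v})" by blast
    have "0 = a \<bullet> (\<Sum>w\<in>S. u w *\<^sub>R phi w)" using that(1) by simp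
    also have "\<dots> = (\<Sum>w\<in>S. u w * (a \<bullet> phi w))" by (simp add: inner_sum_right)
    also have "\<dots> = (\<Sum>w\<in>S. if w = v then u v * (a \<bullet> phi v) else 0)"
      by (rule sum.cong) (use a SV in auto)
    also have "\<dots> = u v * (a \<bullet> phi v)" using finS that(2) by simp
    finally have "u v * (a \<bullet> phi v) = 0" by simp
    moreover have "a \<bullet> phi v \<noteq> 0" using a that(2) SV by auto
    ultimately show ?thesis by simp
  qed
  have ind: "inj_on phi S" "independent (phi ` S)"
    by (rule independent_family[OF finS], erule (1) z)+
  have sub: "phi ` S \<subseteq> face_cone S" using phi_cf[OF fv[OF S(1)] Sne] SV by auto
  have "0 \<in> face_cone S" using face_cone_zero[OF fv[OF S(1)] Sne] .
  then have "int (dim (face_cone S)) = int (card S)"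
    using aff_dim_zero[of "face_cone S"] face_cone_aff_dim[OF F S(1) Sne] by (simp add: hull_inc)
  then have "dim (face_cone S) \<le> card (phi ` S)" using card_image[OF ind(1)] by simp
  then show ?thesis by (rule card_ge_dim_independent[OF sub ind(2)])
qed

lemma k_face:
  assumes F: "simplex_facet V F" and S: "S \<subseteq> F" "card S = Suc k"
  shows "spherical_k_face k (f (convex hull S)) Q"
proof -
  have ne: "S \<noteq> {}" using S by auto
  have fv: "face_vertices V S" by (rule simplex_facet_subset[OF finV F S(1)])
  show ?thesis unfolding spherical_k_face_def
    using face_cone(1,3)[OF fv ne] face_cone_aff_dim[OF F S(1) ne] S(2) by (intro exI[of _ "face_cone S"]) simp
qed

section \<open>Scribed realizations as configurations\<close>

lemma avoiding_functional:
  assumes Qs: "strongly_scribed i j Q" and F: "simplex_facet V F" and S: "S \<subseteq> F" "card S = i + 1"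
  shows "\<exists>n. lor n n \<le> 0 \<and> (\<forall>v\<in>V. n \<bullet> phi v \<le> 0 \<and> (n \<bullet> phi v = 0 \<longleftrightarrow> v \<in> S))"
proof -
  have "strongly_avoids Q (f (convex hull S))"
    using Qs k_face[OF F S(1)] S(2) unfolding strongly_scribed_def by simp
  then obtain a where a: "f (convex hull S) = {x \<in> sphere 0 1. a \<bullet> x = 0} \<inter> Q"
    "Q \<subseteq> hemisphere a" "cap \<subseteq> hemisphere a"
    unfolding strongly_avoids_def supporting_hyperplane_def by blast
  have fv: "face_vertices V S" by (rule simplex_facet_subset[OF finV F S(1)])
  have "a \<bullet> phi v \<le> 0" if "v \<in> V" for v using a(2) phi_Q[OF that] by (auto simp: hemisphere_def)
  moreover have "a \<bullet> phi v = 0 \<longleftrightarrow> v \<in> S" if "v \<in> V" for v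
  proof -
    have "phi v \<in> sphere 0 1" using phi_Q[OF that] unfolding Q by blast
    then show ?thesis using phi_iff[OF fv that] phi_Q[OF that] unfolding a(1) by blast
  qed
  ultimately show ?thesis using lor_nonpos_of_cap[OF a(3)] by blast
qed

definition cut_point :: "(real^'d) set \<Rightarrow> real \<times> (real^'d)" where
  "cut_point S = (SOME x. x \<in> rel_interior (face_cone S) \<inter> cap)"

lemma cut_point:
  assumes Qs: "strongly_scribed i j Q" and F: "simplex_facet V F" and S: "S \<subseteq> F" "card S = j + 1"
  shows "cut_point S \<in> rel_interior (face_cone S) \<inter> cap"
proof -
  have "strongly_cuts (f (convex hull S))"
    using Qs k_face[OF F S(1)] S(2) unfolding strongly_scribed_def by simp
  then have "rel_interior (face_cone S) \<inter> cap \<noteq> {}"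
    unfolding strongly_cuts_def spherical_relint_def face_cone_def by blast
  then show ?thesis unfolding cut_point_def by (simp add: some_in_eq del: Int_iff)
qed

lemma scribed_config:
  assumes Qs: "strongly_scribed i (i + 1) Q" and T: "finite T" "card T = i" and i: "i + 4 \<le> CARD('d)"
  shows "scribed_config phi V {G. simplex_facet V G} T i CARD('d) cut_point"
proof
  show "finite V" by (rule finV)
  show "DIM(real^'d) = CARD('d)" by simp
  show "phi v \<noteq> 0" if "v \<in> V" for v using that by (rule phi_nz)
  show "\<exists>n. \<forall>v\<in>V. n \<bullet> phi v \<le> 0 \<and> (n \<bullet> phi v = 0 \<longleftrightarrow> v \<in> G)" if "G \<in> {G. simplex_facet V G}" for G
    using that simplex_facet_aff_dim(2)[of V G] by (intro support) (auto simp: simplex_facet_def)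
  show "\<exists>n. \<forall>v\<in>V. n \<bullet> phi v \<le> 0 \<and> (n \<bullet> phi v = 0 \<longleftrightarrow> v = w)" if "w \<in> V" for w
    using support[OF vx[OF that]] by simp
  show "\<exists>n. lor n n \<le> 0 \<and> (\<forall>v\<in>V. n \<bullet> phi v \<le> 0 \<and> (n \<bullet> phi v = 0 \<longleftrightarrow> v \<in> S))"
    if "S \<subseteq> G" "G \<in> {G. simplex_facet V G}" "card S = i + 1" for S G
    using avoiding_functional[OF Qs] that by blast
  show "norm (cut_point S) = 1 \<and> 0 \<le> fst (cut_point S) \<and> lor (cut_point S) (cut_point S) \<le> 0 \<and>
      (\<forall>n. (\<forall>s\<in>S. n \<bullet> phi s = 0) \<longrightarrow> n \<bullet> cut_point S = 0)"
    if S: "S \<subseteq> G" "G \<in> {G. simplex_facet V G}" "card S = i + 2" for S G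
  proof -
    have G: "simplex_facet V G" using S by simp
    have c: "cut_point S \<in> rel_interior (face_cone S)" "cut_point S \<in> cap"
      using cut_point[OF Qs G S(1)] S(3) by auto
    have sp: "cut_point S \<in> span (phi ` S)"
      using face_cone_span[OF G S(1)] S(3) c(1) rel_interior_subset by fastforce
    have "n \<bullet> cut_point S = 0" if "\<forall>s\<in>S. n \<bullet> phi s = 0" for n
    proof -
      have "span (phi ` S) \<subseteq> {x. n \<bullet> x = 0}"
        by (rule span_minimal) (use that in \<open>auto simp: subspace_hyperplane\<close>)
      then show ?thesis using sp by blast
    qed
    then show ?thesis using c(2) unfolding cap_lor by blast
  qed
  show "cut_point S \<noteq> cut_point S'"
    if S: "S \<subseteq> G" "G \<in> {G. simplex_facet V G}" "card S = i + 2"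
      "S' \<subseteq> G'" "G' \<in> {G. simplex_facet V G}" "card S' = i + 2" "S \<noteq> S'" for S G S' G'
  proof
    assume e: "cut_point S = cut_point S'"
    have G: "simplex_facet V G" "simplex_facet V G'" using S by auto
    have c: "cut_point S \<in> rel_interior (face_cone S)" "cut_point S' \<in> rel_interior (face_cone S')"
      using cut_point[OF Qs G(1) S(1)] cut_point[OF Qs G(2) S(4)] S(3,6) by auto
    have fv: "face_vertices V S" "face_vertices V S'" "S \<noteq> {}" "S' \<noteq> {}"
      using simplex_facet_subset[OF finV] G S by auto
    \<comment> \<open>Two faces whose relative interiors meet coincide.\<close>
    have "face_cone S = face_cone S'"
      using face_of_eq[OF face_cone(1)[OF fv(1,3)] face_cone(1)[OF fv(2,4)]] c e by auto
    then show False using face_cone_inj fv S(7) by blast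
  qed
qed (use T i in auto)

end

section \<open>Choice of the depth and conclusion\<close>

lemma not_strongly_scribable:
  fixes V :: "(real^'d) set"
  assumes V: "stacked_config V" "deep {G. simplex_facet V G} k F X" "F \<subseteq> V" "X \<subseteq> V"
      "card F = CARD('d)" "w \<in> V" "w \<notin> F \<union> X"
    and i: "i + 4 \<le> CARD('d)"
    and k: "2 * real (CARD('d) - i) < (real (CARD('d) - i) / real (CARD('d) - i - 1)) ^ (k - 1)" "0 < k"
  shows "\<not> strongly_scribable i (i + 1) (convex hull V)"
proof
  assume "strongly_scribable i (i + 1) (convex hull V)"
  then obtain Q :: "(real \<times> (real^'d)) set" where Q: "spherical_polytope Q" "spherical_dim Q = int CARD('d)"
    "inclusion_isomorphic {F. F face_of convex hull V} (spherical_faces Q)"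
    and Qs: "strongly_scribed i (i + 1) Q"
    unfolding strongly_scribable_def spherical_realization_def
    by (elim exE conjE) (rule that, assumption+)
  obtain A where A: "finite A" "0 \<notin> A" "Q = sphere 0 1 \<inter> (\<Inter>a\<in>A. hemisphere a)"
    using Q(1) unfolding spherical_polytope_def by blast
  from Q(3) obtain f where f: "bij_betw f {F. F face_of convex hull V} (spherical_faces Q)"
    "\<forall>F\<in>{F. F face_of convex hull V}. \<forall>G\<in>{F. F face_of convex hull V}. F \<subseteq> G \<longleftrightarrow> f F \<subseteq> f G"
    unfolding inclusion_isomorphic_def by (elim exE conjE) (rule that)
  have order: "F \<subseteq> G \<longleftrightarrow> f F \<subseteq> f G" if "F face_of convex hull V" "G face_of convex hull V" for F G
    using bspec[OF bspec[OF f(2), of F], of G] that by simp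
  have "finite V" "affine hull V = UNIV" "\<And>v. v \<in> V \<Longrightarrow> face_vertices V {v}"
    using V(1) by (simp_all add: stacked_config_def)
  then interpret spherical_lattice V Q f A
    using A Q(2) f(1) order by (rule spherical_lattice.intro)
  obtain T where T: "T \<subseteq> F" "card T = i" "finite T"
    using obtain_subset_with_card_n[of i F] i V(5) by auto
  interpret sc: scribed_config phi V "{G. simplex_facet V G}" T i "CARD('d)" cut_point
    by (rule scribed_config[OF Qs T(3,2) i])
  show False by (rule sc.no_deep_tree[OF V(2-5) T(1) V(6,7) k])
qed

theorem theorem6:
  fixes d i :: nat
  assumes "CARD('d::finite) = d" and "d > 3" and "i \<le> d - 4"
  shows "\<exists>P :: (real^'d) set. stacked P \<and> \<not> strongly_scribable i (i + 1) P"
proof -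
  have i: "i + 4 \<le> CARD('d)" using assms by simp
  let ?D = "CARD('d) - i"
  \<comment> \<open>The growth factor exceeds one, so some power passes \<open>2 * real ?D\<close>.
    The tree has depth \<open>Suc k\<close> because the exponent in the bound is the depth minus
    one.\<close>
  have "1 < real ?D / real (?D - 1)" using i by (simp add: field_simps of_nat_diff)
  then obtain k where k: "2 * real ?D < (real ?D / real (?D - 1)) ^ k"
    using real_arch_pow by blast
  have "2 \<le> CARD('d)" using i by simp
  from stacked_deep_exists[OF this, of "Suc k"] obtain V :: "(real^'d) set" and F X w where
    V: "stacked_config V" "deep {G. simplex_facet V G} (Suc k) F X" "F \<subseteq> V" "X \<subseteq> V"
      "card F = CARD('d)" "w \<in> V" "w \<notin> F \<union> X" by (elim exE conjE) (rule that)
  have "stacked (convex hull V)" using V(1) by (simp add: stacked_config_def)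
  moreover have "\<not> strongly_scribable i (i + 1) (convex hull V)"
    by (rule not_strongly_scribable[OF V i]) (use k in auto)
  ultimately show ?thesis by blast
qed

end
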